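(* Let $d<0$ be the discriminant of an imaginary quadratic field and let $d=q_1^*\cdots q_t^*$ be its factorization into prime discriminants. Assume that all $q_i^*$ are odd and numbered so that $q_i^*>0$ for $1\le i\le u$ and $q_i^*<0$ for $u<i\le t$, where $0\le u\le t-1$. Let $K_G=\mathbb Q(\sqrt{q_1^*},\dots,\sqrt{q_t^*})\subset\mathbb C$. 1. Define, for $(s_1,\dots,s_{t-1})\in\{0,1\}^{t-1}$, $$\beta_{s_1,\dots,s_{t-1}}=\left(\prod_{i=1}^u\tilde\alpha_i^{s_i}\alpha_i^{1-s_i}\right)\left(\left(\prod_{i=u+1}^{t-1}\tilde\alpha_i^{s_i}\alpha_i^{1-s_i}\right)\alpha_t+\left(\prod_{i=u+1}^{t-1}\tilde\alpha_i^{1-s_i}\alpha_i^{s_i}\right)\tilde\alpha_t\right).$$ The set $\{\beta_{s_1,\dots,s_{t-1}}:(s_1,\dots,s_{t-1})\in\{0,1\}^{t-1}\}$ is a $\mathbb Z$-basis of the ring of integers of $K_G\cap\mathbb R$. 2. Define $$\beta^*_{s_1,\dots,s_{t-1}}=\left(\prod_{i=1}^u(-\tilde\alpha_i)^{s_i}\alpha_i^{1-s_i}\right)\left(\left(\prod_{i=u+1}^{t-1}(-\tilde\alpha_i)^{s_i}\alpha_i^{1-s_i}\right)\alpha_t-\left(\prod_{i=u+1}^{t-1}\tilde\alpha_i^{1-s_i}(-\alpha_i)^{s_i}\right)\tilde\alpha_t\right).$$ The set $\{\beta^*_{s_1,\dots,s_{t-1}}:(s_1,\dots,s_{t-1})\in\{0,1\}^{t-1}\}$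 is a $\mathbb Z$-basis of the $\mathbb Z$-module $\mathcal O_{K_G}\cap i\mathbb R$. 3. For any $\eta,\nu\in\{0,1\}^{t-1}$, $$\sum_{\mu\in\{0,1\}^{t-1}}(-1)^{\mu_1+\dots+\mu_{t-1}}\tau_\mu\left(\beta_{\eta_1,\dots,\eta_{t-1}}\beta^*_{\nu_1,\dots,\nu_{t-1}}\right)=\begin{cases}\sqrt d,&\text{if }\eta=\nu,\\0,&\text{otherwise.}\end{cases}$$
   Context: The factorization of $d$ into prime discriminants is the unique (up to order) representation $d=q_1^*\cdots q_t^*$ with pairwise relatively prime $q_i^*$, each being either $(-1)^{(q-1)/2}q$ for an odd prime $q>0$ or an element of $\{-4,8,-8\}$. Fix a complex square root $\sqrt{q_i^*}$ for each $i$; $\sqrt d$ denotes the square root of $d$ equal to $\sqrt{q_1^*}\cdots\sqrt{q_t^*}$. Put $\alpha_i=\frac{1+\sqrt{q_i^*}}2$, $\tilde\alpha_i=\frac{1-\sqrt{q_i^*}}2$. One has $[K_G:\mathbb Q]=2^t$, and for $1\le j\le t$, $\tau_j\in\mathrm{Gal}(K_G/\mathbb Q)$ is the automorphism with $\tau_j(\sqrt{q_j^*})=-\sqrt{q_j^*}$ and $\tau_j(\sqrt{q_i^*})=\sqrt{q_i^*}$ for $i\neq j$. For $\lambda\in\{0,1\}^{t-1}$, $\tau_\lambda=\tau_1^{\lambda_1}\cdots\tau_{t-1}^{\lambda_{t-1}}$. $\mathcal O_{K_G}$ is the ring of integers of $K_G$. Empty products equal $1$. *)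

theory Defs
  imports
    Complex_Main
    "HOL-Library.FuncSet"
    "HOL-Computational_Algebra.Computational_Algebra"
begin

interpretation int_complex: module "\<lambda>(n::int) (z::complex). of_int n * z"
  by unfold_locales (simp_all add: algebra_simps)

interpretation rat_complex: vector_space "\<lambda>(q::rat) (z::complex). of_rat q * z"
  by unfold_locales (simp_all add: algebra_simps of_rat_add of_rat_mult)

definition Z_basis :: "complex set \<Rightarrow> complex set \<Rightarrow> bool" where
  "Z_basis B M \<longleftrightarrow> int_complex.independent B \<and> int_complex.span B = M"

definition complex_subfield :: "complex set \<Rightarrow> bool" where
  "complex_subfield K \<longleftrightarrow> 1 \<in> K \<and> (\<forall>x\<in>K. \<forall>y\<in>K. x - y \<in> K \<and> x * y \<in> K) \<and> (\<forall>x\<in>K. inverse x \<in> K)"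

definition ring_of_integers :: "complex set \<Rightarrow> complex set" where
  "ring_of_integers K = {x \<in> K. algebraic_int x}"

definition imaginary_axis :: "complex set" where
  "imaginary_axis = range (\<lambda>y::real. \<i> * of_real y)"

definition imaginary_quadratic_field :: "complex set \<Rightarrow> bool" where
  "imaginary_quadratic_field K \<longleftrightarrow>
     complex_subfield K \<and> rat_complex.dim K = 2 \<and> \<not> K \<subseteq> \<real>"

(* The two embeddings of an imaginary quadratic field into the complex numbers are the inclusion
   and its complex conjugate, so the discriminant is the square of the 2x2 determinant below. *)
definition imaginary_quadratic_discriminant :: "int \<Rightarrow> bool" where
  "imaginary_quadratic_discriminant d \<longleftrightarrow>
     (\<exists>K w1 w2. imaginary_quadratic_field K \<and> Z_basis {w1, w2} (ring_of_integers K) \<and>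
        of_int d = (w1 * cnj w2 - w2 * cnj w1)\<^sup>2)"

definition prime_discriminant :: "int \<Rightarrow> bool" where
  "prime_discriminant x \<longleftrightarrow>
     x \<in> {-4, 8, -8} \<or> (\<exists>p::nat. prime p \<and> odd p \<and> x = (-1) ^ ((p - 1) div 2) * int p)"

definition prime_discriminant_factorization :: "int \<Rightarrow> nat \<Rightarrow> (nat \<Rightarrow> int) \<Rightarrow> bool" where
  "prime_discriminant_factorization d t q \<longleftrightarrow>
     (\<forall>i\<in>{1..t}. prime_discriminant (q i)) \<and>
     (\<forall>i\<in>{1..t}. \<forall>j\<in>{1..t}. i \<noteq> j \<longrightarrow> coprime (q i) (q j)) \<and>
     d = (\<Prod>i=1..t. q i)"

(* Functions are extensional outside K so that automorphisms of K are determined by their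
   values on K; this makes the definite description in tau meaningful. *)
definition galois_group :: "complex set \<Rightarrow> complex set \<Rightarrow> (complex \<Rightarrow> complex) set" where
  "galois_group K F = {\<sigma> \<in> extensional K. bij_betw \<sigma> K K \<and>
     (\<forall>x\<in>K. \<forall>y\<in>K. \<sigma> (x + y) = \<sigma> x + \<sigma> y \<and> \<sigma> (x * y) = \<sigma> x * \<sigma> y) \<and>
     (\<forall>x\<in>F. \<sigma> x = x)}"

(* In the following, r i is the chosen square root of the i-th prime discriminant, 1 \<le> i \<le> t. *)

definition KG :: "nat \<Rightarrow> (nat \<Rightarrow> complex) \<Rightarrow> complex set" where
  "KG t r = complex_subfield hull (r ` {1..t})"

definition tau :: "nat \<Rightarrow> (nat \<Rightarrow> complex) \<Rightarrow> nat \<Rightarrow> complex \<Rightarrow> complex" where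
  "tau t r j = (THE \<sigma>. \<sigma> \<in> galois_group (KG t r) \<rat> \<and> \<sigma> (r j) = - r j \<and>
     (\<forall>i\<in>{1..t} - {j}. \<sigma> (r i) = r i))"

definition bits :: "nat \<Rightarrow> (nat \<Rightarrow> nat) set" where
  "bits t = {1..t - 1} \<rightarrow>\<^sub>E {0, 1}"

(* The composite agrees with the Galois group product on KG t r, the only place it is applied. *)
definition tau_prod :: "nat \<Rightarrow> (nat \<Rightarrow> complex) \<Rightarrow> (nat \<Rightarrow> nat) \<Rightarrow> complex \<Rightarrow> complex" where
  "tau_prod t r l = foldr (\<lambda>j f. (tau t r j ^^ l j) \<circ> f) [1..<t] id"

definition alpha :: "(nat \<Rightarrow> complex) \<Rightarrow> nat \<Rightarrow> complex" where
  "alpha r i = (1 + r i) / 2"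

definition alpha_tilde :: "(nat \<Rightarrow> complex) \<Rightarrow> nat \<Rightarrow> complex" where
  "alpha_tilde r i = (1 - r i) / 2"

definition beta :: "nat \<Rightarrow> nat \<Rightarrow> (nat \<Rightarrow> complex) \<Rightarrow> (nat \<Rightarrow> nat) \<Rightarrow> complex" where
  "beta t u r s =
     (\<Prod>i=1..u. alpha_tilde r i ^ s i * alpha r i ^ (1 - s i)) *
     ((\<Prod>i=u+1..t-1. alpha_tilde r i ^ s i * alpha r i ^ (1 - s i)) * alpha r t +
      (\<Prod>i=u+1..t-1. alpha_tilde r i ^ (1 - s i) * alpha r i ^ s i) * alpha_tilde r t)"

definition beta_star :: "nat \<Rightarrow> nat \<Rightarrow> (nat \<Rightarrow> complex) \<Rightarrow> (nat \<Rightarrow> nat) \<Rightarrow> complex" where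
  "beta_star t u r s =
     (\<Prod>i=1..u. (- alpha_tilde r i) ^ s i * alpha r i ^ (1 - s i)) *
     ((\<Prod>i=u+1..t-1. (- alpha_tilde r i) ^ s i * alpha r i ^ (1 - s i)) * alpha r t -
      (\<Prod>i=u+1..t-1. alpha_tilde r i ^ (1 - s i) * (- alpha r i) ^ s i) * alpha_tilde r t)"

end

theory Submission
  imports Defs "Jordan_Normal_Form.Char_Poly"
begin

text \<open>
  Write \<open>a\<^sub>i(n) = (1 + (-1)\<^sup>n r\<^sub>i) / 2\<close>, which is \<open>\<alpha>\<^sub>i\<close> for even \<open>n\<close> and its conjugate for odd \<open>n\<close>.
  Complex conjugation negates exactly the \<open>r\<^sub>i\<close> with \<open>i > u\<close>, so up to sign the elements
  \<open>\<beta>\<^sub>s\<close> and \<open>\<beta>\<^sub>s\<^sup>*\<close> are \<open>h + cnj h\<close> and \<open>h - cnj h\<close> for the product \<open>h\<close> of the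
  \<open>a\<^sub>i(s\<^sub>i)\<close> and \<open>a\<^sub>t(0)\<close> (\<open>half_beta\<close>).

  The core is the duality of the two families under the signed trace
  \<open>x \<mapsto> \<Sum>\<^sub>\<mu> (-1)\<^bsup>|\<mu>|\<^esup> \<tau>\<^sub>\<mu>(x)\<close>.  Expanding \<open>\<beta>\<^sub>\<eta> \<beta>\<^sub>\<nu>\<^sup>*\<close> gives four products over
  \<open>i\<close>, and since \<open>\<tau>\<^sub>\<mu>\<close> only shifts the index of \<open>a\<^sub>i\<close> by \<open>\<mu>\<^sub>i\<close>, the signed trace of each
  is, up to the factors with index \<open>t\<close>, a product of the local sums \<open>a\<^sub>i(k) a\<^sub>i(l) - a\<^sub>i(k+1) a\<^sub>i(l+1)\<close>, which are \<open>\<plusminus> r\<^sub>i\<close> or \<open>0\<close>.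
  Because \<open>d < 0\<close>, the number \<open>t - u\<close> of negative factors is odd; this makes the two mixed terms
  cancel and the other two combine to \<open>\<surd>d\<close> or \<open>0\<close> (\<open>beta_duality\<close>).

  Duality yields the integral bases.  The products of the \<open>a\<^sub>i(s\<^sub>i)\<close> over all \<open>i \<le> t\<close> span \<open>K\<^sub>G\<close>
  over the rationals (\<open>hull_sqrts_subset_span\<close>), and a real (imaginary) element is half the sum
  (difference) of itself and its conjugate, so it is a rational combination of the \<open>\<beta>\<^sub>s\<close> (of the
  \<open>\<beta>\<^sub>s\<^sup>*\<close>).  For an algebraic integer \<open>x = \<Sum>\<^sub>s c\<^sub>s \<beta>\<^sub>s\<close>, the signed trace of \<open>x \<beta>\<^sub>s\<^sup>*\<close> is
  \<open>c\<^sub>s \<surd>d\<close>, and it is again an algebraic integer; hence \<open>c\<^sub>s\<^sup>2 d\<close> is an integer, and \<open>c\<^sub>s\<close> is one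
  because \<open>d\<close> is squarefree (\<open>Z_basis_by_duality\<close>).

  Two pieces of general theory enter: algebraic integers are closed under addition and multiplication,
  and no nonempty product of distinct \<open>r\<^sub>i\<close> lies in the field generated by the other ones, so that the
  automorphisms \<open>\<tau>\<^sub>j\<close> exist (\<open>prod_sqrts_notin_hull\<close>, \<open>tau_characterization\<close>).
\<close>

section \<open>The ring of algebraic integers\<close>

(* Leaves the dollar sign to vector indexing. *)
unbundle no fps_syntax

lemma int_span_mult_closed:
  assumes "\<And>b. b \<in> B \<Longrightarrow> x * b \<in> int_complex.span B" and "y \<in> int_complex.span B"
  shows "x * y \<in> int_complex.span B"
  using assms(2)
proof (induction rule: int_complex.span_induct_alt)
  case base
  show ?case by (simp add: int_complex.span_zero)
next
  case (step c b y)
  have "x * (of_int c * b + y) = of_int c * (x * b) + x * y"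
    by (simp add: algebra_simps)
  then show ?case
    using step assms(1) int_complex.span_add int_complex.span_scale by presburger
qed

text \<open>Multiplication by \<open>x\<close> acts on the generators \<open>B\<close> by an integer matrix, and the vector of the
generators is an eigenvector of it with eigenvalue \<open>x\<close>.  So \<open>x\<close> is a root of the characteristic
polynomial, which is monic with integer coefficients.\<close>

lemma algebraic_int_if_stabilizes_span:
  fixes x :: complex
  assumes fin: "finite B" and b0: "b0 \<in> B" "b0 \<noteq> 0"
    and stable: "\<And>b. b \<in> B \<Longrightarrow> x * b \<in> int_complex.span B"
  shows "algebraic_int x"
proof -
  have "\<exists>f. x * b = (\<Sum>c\<in>B. of_int (f c) * c)" if "b \<in> B" for b
    using stable[OF that] unfolding int_complex.span_finite[OF fin] by auto
  then obtain a where a: "x * b = (\<Sum>c\<in>B. of_int (a b c) * c)" if "b \<in> B" for b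
    by metis
  define n where "n = card B"
  obtain h where h: "bij_betw h {0..<n} B"
    using ex_bij_betw_nat_finite[OF fin] unfolding n_def by auto
  define A :: "int mat" where "A = mat n n (\<lambda>(i, j). a (h i) (h j))"
  define v :: "complex vec" where "v = vec n h"
  have A: "A \<in> carrier_mat n n"
    by (simp add: A_def)
  have hB: "h i \<in> B" if "i < n" for i
    using h that by (auto simp: bij_betw_def)
  obtain i0 where i0: "i0 < n" "h i0 = b0"
    using h b0 by (auto simp: bij_betw_def)
  have "v \<noteq> 0\<^sub>v n"
    using i0 b0 by (metis index_vec index_zero_vec(1) v_def)
  moreover have "map_mat of_int A *\<^sub>v v = x \<cdot>\<^sub>v v"
  proof (rule eq_vecI)
    fix i assume "i < dim_vec (x \<cdot>\<^sub>v v)"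
    then have i: "i < n" by (simp add: v_def)
    have "(map_mat of_int A *\<^sub>v v) $ i = (\<Sum>j\<in>{0..<n}. of_int (a (h i) (h j)) * h j)"
      using i by (simp add: A_def v_def scalar_prod_def)
    also have "\<dots> = (\<Sum>c\<in>B. of_int (a (h i) c) * c)"
      using h by (rule sum.reindex_bij_betw)
    also have "\<dots> = x * h i"
      using a[OF hB[OF i]] by simp
    finally show "(map_mat of_int A *\<^sub>v v) $ i = (x \<cdot>\<^sub>v v) $ i"
      using i by (simp add: v_def)
  qed (simp add: A_def v_def)
  ultimately have "eigenvalue (map_mat of_int A) x"
    unfolding eigenvalue_def eigenvector_def using A
    by (intro exI[of _ v]) (simp add: v_def)
  then have "poly (char_poly (map_mat of_int A)) x = 0"
    using A eigenvalue_root_char_poly[of "map_mat of_int A" n x] by simp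
  then have "poly (map_poly of_int (char_poly A)) x = 0"
    by (simp add: of_int_hom.char_poly_hom[OF A])
  moreover have "lead_coeff (char_poly A) = 1"
    using degree_monic_char_poly[OF A] by simp
  ultimately show ?thesis
    unfolding algebraic_int_altdef_ipoly by blast
qed

lemma algebraic_int_power_in_span:
  fixes x :: complex
  assumes "algebraic_int x"
  obtains m where "m > 0" "x ^ m \<in> int_complex.span ((\<lambda>i. x ^ i) ` {..<m})"
proof -
  obtain p where p: "lead_coeff p = 1" "\<forall>i. coeff p i \<in> \<int>" "poly p x = 0"
    using assms by (auto simp: algebraic_int.simps)
  let ?m = "degree p"
  have "?m > 0"
    using p by (intro Nat.gr0I) (auto elim!: degree_eq_zeroE)
  moreover have "x ^ ?m \<in> int_complex.span ((\<lambda>i. x ^ i) ` {..<?m})"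
  proof -
    have "{..?m} = insert ?m {..<?m}" by auto
    then have "x ^ ?m + (\<Sum>i<?m. coeff p i * x ^ i) = 0"
      using p by (simp add: poly_altdef)
    then have "x ^ ?m = - (\<Sum>i<?m. coeff p i * x ^ i)"
      by (simp add: eq_neg_iff_add_eq_0)
    moreover have "(\<Sum>i<?m. coeff p i * x ^ i) \<in> int_complex.span ((\<lambda>i. x ^ i) ` {..<?m})"
    proof (rule int_complex.span_sum)
      fix i assume "i \<in> {..<?m}"
      moreover obtain k where "coeff p i = of_int k"
        using p(2) by (metis Ints_cases)
      ultimately show "coeff p i * x ^ i \<in> int_complex.span ((\<lambda>i. x ^ i) ` {..<?m})"
        by (simp add: int_complex.span_base int_complex.span_scale)
    qed
    ultimately show ?thesis
      by (simp add: int_complex.span_neg)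
  qed
  ultimately show ?thesis by (rule that)
qed

text \<open>The monomials \<open>x\<^sup>i y\<^sup>j\<close> with exponents below the degrees of monic equations for \<open>x\<close> and \<open>y\<close> span a
finitely generated module that both \<open>x\<close> and \<open>y\<close>, hence also \<open>x + y\<close> and \<open>x y\<close>, map into itself.\<close>

lemma common_stable_span:
  fixes x y :: complex
  assumes "algebraic_int x" "algebraic_int y"
  obtains B where "finite B" "1 \<in> B"
    "\<And>b. b \<in> B \<Longrightarrow> x * b \<in> int_complex.span B" "\<And>b. b \<in> B \<Longrightarrow> y * b \<in> int_complex.span B"
proof -
  obtain m where m: "m > 0" "x ^ m \<in> int_complex.span ((\<lambda>i. x ^ i) ` {..<m})"
    using algebraic_int_power_in_span assms(1) by blast
  obtain n where n: "n > 0" "y ^ n \<in> int_complex.span ((\<lambda>i. y ^ i) ` {..<n})"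
    using algebraic_int_power_in_span assms(2) by blast
  define B where "B = (\<lambda>(i, j). x ^ i * y ^ j) ` ({..<m} \<times> {..<n})"
  have B: "x ^ i * y ^ j \<in> B" if "i < m" "j < n" for i j
    using that by (auto simp: B_def)
  have times_y: "z * y ^ j \<in> int_complex.span B"
    if "z \<in> int_complex.span ((\<lambda>i. x ^ i) ` {..<m})" "j < n" for z j
    using that(1)
  proof (induction rule: int_complex.span_induct_alt)
    case (step c b z)
    have "(of_int c * b + z) * y ^ j = of_int c * (b * y ^ j) + z * y ^ j"
      by (simp add: algebra_simps)
    moreover have "b * y ^ j \<in> int_complex.span B"
      using step(1) B that(2) by (auto intro: int_complex.span_base)
    ultimately show ?case
      using step(2) by (simp add: int_complex.span_add int_complex.span_scale)
  qed (simp add: int_complex.span_zero)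
  have times_x: "x ^ i * z \<in> int_complex.span B"
    if "z \<in> int_complex.span ((\<lambda>i. y ^ i) ` {..<n})" "i < m" for z i
    using that(1)
  proof (induction rule: int_complex.span_induct_alt)
    case (step c b z)
    have "x ^ i * (of_int c * b + z) = of_int c * (x ^ i * b) + x ^ i * z"
      by (simp add: algebra_simps)
    moreover have "x ^ i * b \<in> int_complex.span B"
      using step(1) B that(2) by (auto intro: int_complex.span_base)
    ultimately show ?case
      using step(2) by (simp add: int_complex.span_add int_complex.span_scale)
  qed (simp add: int_complex.span_zero)
  have x: "x * (x ^ i * y ^ j) \<in> int_complex.span B" if ij: "i < m" "j < n" for i j
  proof (cases "Suc i < m")
    case True
    then show ?thesis
      using B[OF True ij(2)] by (simp add: mult.assoc int_complex.span_base)
  next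
    case False
    then have "m = Suc i" using ij by simp
    then show ?thesis
      using times_y[OF m(2) ij(2)] by (simp add: mult.assoc)
  qed
  have y: "y * (x ^ i * y ^ j) \<in> int_complex.span B" if ij: "i < m" "j < n" for i j
  proof (cases "Suc j < n")
    case True
    then show ?thesis
      using B[OF ij(1) True] by (simp add: mult.left_commute int_complex.span_base)
  next
    case False
    then have "n = Suc j" using ij by simp
    then show ?thesis
      using times_x[OF n(2) ij(1)] by (simp add: mult.left_commute)
  qed
  show ?thesis
  proof (rule that[of B])
    show "finite B" by (simp add: B_def)
    show "1 \<in> B" using B[of 0 0] m(1) n(1) by simp
  qed (use x y in \<open>auto simp: B_def\<close>)
qed

lemma algebraic_int_add:
  fixes x y :: complex
  assumes "algebraic_int x" "algebraic_int y"
  shows "algebraic_int (x + y)"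
proof -
  obtain B where B: "finite B" "1 \<in> B"
    "\<And>b. b \<in> B \<Longrightarrow> x * b \<in> int_complex.span B" "\<And>b. b \<in> B \<Longrightarrow> y * b \<in> int_complex.span B"
    using common_stable_span[OF assms] by metis
  show ?thesis
    by (rule algebraic_int_if_stabilizes_span[OF B(1,2)])
      (auto simp: distrib_right intro!: int_complex.span_add B)
qed

lemma algebraic_int_mult:
  fixes x y :: complex
  assumes "algebraic_int x" "algebraic_int y"
  shows "algebraic_int (x * y)"
proof -
  obtain B where B: "finite B" "1 \<in> B"
    "\<And>b. b \<in> B \<Longrightarrow> x * b \<in> int_complex.span B" "\<And>b. b \<in> B \<Longrightarrow> y * b \<in> int_complex.span B"
    using common_stable_span[OF assms] by metis
  show ?thesis
    by (rule algebraic_int_if_stabilizes_span[OF B(1,2)])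
      (auto simp: mult.assoc intro!: int_span_mult_closed[OF B(3)] B(4))
qed

lemma algebraic_int_sum:
  fixes f :: "'a \<Rightarrow> complex"
  assumes "\<And>i. i \<in> A \<Longrightarrow> algebraic_int (f i)"
  shows "algebraic_int (sum f A)"
  using assms by (induction A rule: infinite_finite_induct) (auto intro: algebraic_int_add)

lemma algebraic_int_prod:
  fixes f :: "'a \<Rightarrow> complex"
  assumes "\<And>i. i \<in> A \<Longrightarrow> algebraic_int (f i)"
  shows "algebraic_int (prod f A)"
  using assms by (induction A rule: infinite_finite_induct) (auto intro: algebraic_int_mult)

text \<open>If \<open>c = a / b\<close> in lowest terms, then \<open>b\<^sup>2\<close> divides \<open>a\<^sup>2 n\<close>, hence \<open>n\<close>, so \<open>b\<close> is a unit.\<close>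

lemma rational_int_if_square_times_squarefree_int:
  fixes c :: complex and n :: int
  assumes "c \<in> \<rat>" "squarefree n" "algebraic_int (c\<^sup>2 * of_int n)"
  shows "c \<in> \<int>"
proof -
  obtain a b :: int where ab: "b > 0" "coprime a b" "c = of_int a / of_int b"
    using \<open>c \<in> \<rat>\<close> by (auto elim: Rats_cases')
  have "c\<^sup>2 * of_int n \<in> \<int>"
    using assms by (intro rational_algebraic_int_is_int) auto
  then obtain k where "c\<^sup>2 * of_int n = of_int k"
    by (auto elim: Ints_cases)
  then have "of_int (a\<^sup>2 * n) = (of_int (b\<^sup>2 * k) :: complex)"
    using ab(1) unfolding ab(3) by (simp add: power_divide mult.commute nonzero_eq_divide_eq divide_eq_eq)
  then have "b\<^sup>2 dvd a\<^sup>2 * n"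
    by (simp only: of_int_eq_iff dvd_triv_left)
  moreover have "coprime (b\<^sup>2) (a\<^sup>2)"
    using ab(2) by (simp add: coprime_commute)
  ultimately have "b\<^sup>2 dvd n"
    by (simp add: coprime_dvd_mult_right_iff)
  then have "b dvd 1"
    using \<open>squarefree n\<close> by (simp add: squarefree_def)
  then show ?thesis
    using ab by simp
qed

section \<open>Subfields and adjunction of square roots\<close>

lemma complex_subfield_closed:
  assumes "complex_subfield K"
  shows subfield_one: "1 \<in> K"
    and subfield_zero: "0 \<in> K"
    and subfield_diff: "\<And>x y. x \<in> K \<Longrightarrow> y \<in> K \<Longrightarrow> x - y \<in> K"
    and subfield_mult: "\<And>x y. x \<in> K \<Longrightarrow> y \<in> K \<Longrightarrow> x * y \<in> K"
    and subfield_inverse: "\<And>x. x \<in> K \<Longrightarrow> inverse x \<in> K"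
    and subfield_uminus: "\<And>x. x \<in> K \<Longrightarrow> - x \<in> K"
    and subfield_add: "\<And>x y. x \<in> K \<Longrightarrow> y \<in> K \<Longrightarrow> x + y \<in> K"
proof -
  show 1: "1 \<in> K"
    and diff: "\<And>x y. x \<in> K \<Longrightarrow> y \<in> K \<Longrightarrow> x - y \<in> K"
    and "\<And>x y. x \<in> K \<Longrightarrow> y \<in> K \<Longrightarrow> x * y \<in> K"
    and "\<And>x. x \<in> K \<Longrightarrow> inverse x \<in> K"
    using assms by (auto simp: complex_subfield_def)
  show 0: "0 \<in> K"
    using diff[OF 1 1] by simp
  show neg: "- x \<in> K" if "x \<in> K" for x
    using diff[OF 0 that] by simp
  show "x + y \<in> K" if "x \<in> K" "y \<in> K" for x y
    using diff[OF that(1) neg[OF that(2)]] by simp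
qed

lemma complex_subfieldI:
  assumes "1 \<in> K" "\<And>x y. x \<in> K \<Longrightarrow> y \<in> K \<Longrightarrow> x - y \<in> K"
    and "\<And>x y. x \<in> K \<Longrightarrow> y \<in> K \<Longrightarrow> x * y \<in> K" "\<And>x. x \<in> K \<Longrightarrow> inverse x \<in> K"
  shows "complex_subfield K"
  using assms by (auto simp: complex_subfield_def)

lemma subfield_divide:
  "complex_subfield K \<Longrightarrow> x \<in> K \<Longrightarrow> y \<in> K \<Longrightarrow> x / y \<in> K"
  by (simp add: divide_inverse subfield_inverse subfield_mult)

lemma subfield_sum:
  assumes "complex_subfield K" "\<And>i. i \<in> A \<Longrightarrow> f i \<in> K"
  shows "sum f A \<in> K"
  using assms(2)
  by (induction A rule: infinite_finite_induct)
    (auto intro: subfield_zero[OF assms(1)] subfield_add[OF assms(1)])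

lemma subfield_prod:
  assumes "complex_subfield K" "\<And>i. i \<in> A \<Longrightarrow> f i \<in> K"
  shows "prod f A \<in> K"
  using assms(2)
  by (induction A rule: infinite_finite_induct)
    (auto intro: subfield_one[OF assms(1)] subfield_mult[OF assms(1)])

lemma subfield_of_int:
  assumes "complex_subfield K"
  shows "of_int n \<in> K"
proof (induction n rule: int_induct[where k = 0])
  case (step2 i)
  then show ?case
    by (simp add: subfield_diff[OF assms] subfield_one[OF assms])
qed (auto simp: subfield_zero[OF assms] subfield_add[OF assms] subfield_one[OF assms])

lemma subfield_Rats:
  assumes "complex_subfield K"
  shows "\<rat> \<subseteq> K"
  by (auto elim!: Rats_cases' intro!: subfield_divide[OF assms] subfield_of_int[OF assms])

lemma complex_subfield_Rats: "complex_subfield \<rat>"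
  by (auto simp: complex_subfield_def)

lemma complex_subfield_Reals: "complex_subfield \<real>"
  by (auto simp: complex_subfield_def)

lemma complex_subfield_hull: "complex_subfield (complex_subfield hull S)"
  by (rule hull_in) (auto simp: complex_subfield_def)

lemma subfield_adjoin_sqrt:
  assumes L: "complex_subfield L" and c: "c\<^sup>2 \<in> L"
  shows "complex_subfield {a + b * c |a b. a \<in> L \<and> b \<in> L}" (is "complex_subfield ?M")
proof (cases "c \<in> L")
  case True
  have "?M \<subseteq> L"
    using True by (auto intro: subfield_add[OF L] subfield_mult[OF L])
  moreover have "L \<subseteq> ?M"
  proof
    fix a assume "a \<in> L"
    then show "a \<in> ?M"
      using subfield_zero[OF L] by (intro CollectI exI[of _ a] exI[of _ 0]) simp
  qed
  ultimately have "?M = L"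
    by (rule subset_antisym)
  then show ?thesis
    using L by simp
next
  case False
  note closed = subfield_diff[OF L] subfield_mult[OF L] subfield_add[OF L] subfield_uminus[OF L]
    subfield_divide[OF L] c
  have M: "a + b * c \<in> ?M" if "a \<in> L" "b \<in> L" for a b
    using that by blast
  have one: "1 \<in> ?M"
    using M[OF subfield_one[OF L] subfield_zero[OF L]] by simp
  have diff: "x - y \<in> ?M" and mult: "x * y \<in> ?M" if xy: "x \<in> ?M" "y \<in> ?M" for x y
  proof -
    obtain a b a' b' where ab: "a \<in> L" "b \<in> L" "a' \<in> L" "b' \<in> L" "x = a + b * c" "y = a' + b' * c"
      using xy by blast
    have *: "x - y = (a - a') + (b - b') * c"
      by (simp add: ab algebra_simps)
    show "x - y \<in> ?M"
      unfolding * by (intro M closed ab)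
    have *: "x * y = (a * a' + b * b' * c\<^sup>2) + (a * b' + b * a') * c"
      by (simp add: ab algebra_simps power2_eq_square)
    show "x * y \<in> ?M"
      unfolding * by (intro M closed ab)
  qed
  (* Rationalize the denominator: x times its conjugate lies in L. *)
  have inv: "inverse x \<in> ?M" if x: "x \<in> ?M" for x
  proof (cases "x = 0")
    case True
    then show ?thesis using x by simp
  next
    case x0: False
    obtain a b where ab: "a \<in> L" "b \<in> L" "x = a + b * c"
      using x by blast
    have "a - b * c \<noteq> 0"
    proof
      assume *: "a - b * c = 0"
      show False
      proof (cases "b = 0")
        case True
        then show ?thesis using * ab x0 by simp
      next
        case False
        then have "c = a / b" using * by (simp add: field_simps)
        then show ?thesis using \<open>c \<notin> L\<close> closed(5)[OF ab(1,2)] by simp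
      qed
    qed
    moreover have norm: "(a + b * c) * (a - b * c) = a\<^sup>2 - b\<^sup>2 * c\<^sup>2"
      by (simp add: algebra_simps power2_eq_square)
    ultimately have nz: "a\<^sup>2 - b\<^sup>2 * c\<^sup>2 \<noteq> 0"
      using x0 ab(3) by (metis mult_eq_0_iff)
    have "x * ((a - b * c) / (a\<^sup>2 - b\<^sup>2 * c\<^sup>2)) = 1"
      using nz norm ab by simp
    then have "inverse x = (a - b * c) / (a\<^sup>2 - b\<^sup>2 * c\<^sup>2)"
      by (rule inverse_unique)
    also have "\<dots> = a / (a\<^sup>2 - b\<^sup>2 * c\<^sup>2) + (- b / (a\<^sup>2 - b\<^sup>2 * c\<^sup>2)) * c"
      by (simp add: diff_divide_distrib)
    finally have *: "inverse x = \<dots>" .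
    have "a * a - b * b * c\<^sup>2 \<in> L"
      by (intro closed ab)
    then have nL: "a\<^sup>2 - b\<^sup>2 * c\<^sup>2 \<in> L"
      by (simp add: power2_eq_square)
    show ?thesis
      unfolding * by (intro M closed nL ab)
  qed
  show ?thesis
    by (rule complex_subfieldI[OF one diff mult inv])
qed

lemma hull_insert_sqrt:
  assumes "c\<^sup>2 \<in> complex_subfield hull S"
  shows "complex_subfield hull (insert c S) =
    {a + b * c |a b. a \<in> complex_subfield hull S \<and> b \<in> complex_subfield hull S}" (is "_ = ?M")
proof (rule hull_unique)
  let ?L = "complex_subfield hull S"
  note L = complex_subfield_hull[of S]
  have "S \<subseteq> ?M"
  proof
    fix a assume "a \<in> S"
    then show "a \<in> ?M"
      using subfield_zero[OF L] by (intro CollectI exI[of _ a] exI[of _ 0]) (simp add: hull_inc)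
  qed
  moreover have "c \<in> ?M"
    using subfield_zero[OF L] subfield_one[OF L]
    by (intro CollectI exI[of _ 0] exI[of _ 1]) simp
  ultimately show "insert c S \<subseteq> ?M" by simp
  show "complex_subfield ?M"
    using L assms by (rule subfield_adjoin_sqrt)
  fix M assume M: "insert c S \<subseteq> M" "complex_subfield M"
  then have "?L \<subseteq> M"
    by (intro hull_minimal) auto
  moreover have "c \<in> M"
    using M by simp
  ultimately have "a + b * c \<in> M" if "a \<in> ?L" "b \<in> ?L" for a b
    using that by (intro subfield_add[OF M(2)] subfield_mult[OF M(2)]) blast+
  then show "?M \<subseteq> M"
    by blast
qed

text \<open>By induction on \<open>T\<close>.  A relation \<open>r\<^sub>U = a + b r\<^sub>j\<close> over the field \<open>L\<close> generated by the smaller set gives,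
after squaring, \<open>2 a b r\<^sub>j \<in> L\<close>.  Then \<open>r\<^sub>j\<close>, \<open>r\<^sub>U\<close> or \<open>r\<^sub>U r\<^sub>j\<close> lies in \<open>L\<close>, and each of them is again a
product of square roots with indices outside the smaller set; this is why the claim is about
products and not only about single square roots.\<close>

lemma prod_sqrts_notin_hull:
  fixes r :: "'a \<Rightarrow> complex"
  assumes sq: "\<And>i. i \<in> I \<Longrightarrow> (r i)\<^sup>2 \<in> \<rat>"
    and irr: "\<And>U. finite U \<Longrightarrow> U \<noteq> {} \<Longrightarrow> U \<subseteq> I \<Longrightarrow> prod r U \<notin> \<rat>"
    and "finite T" "T \<subseteq> I" "finite U" "U \<noteq> {}" "U \<subseteq> I" "T \<inter> U = {}"
  shows "prod r U \<notin> complex_subfield hull (r ` T)"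
  using assms(3-)
proof (induction T arbitrary: U rule: finite_induct)
  case empty
  have "complex_subfield hull {} \<subseteq> \<rat>"
    by (rule hull_minimal) (auto simp: complex_subfield_Rats)
  then show ?case
    using irr empty by auto
next
  case (insert j T)
  let ?L = "complex_subfield hull (r ` T)"
  note L = complex_subfield_hull[of "r ` T"]
  have sqL: "(r i)\<^sup>2 \<in> ?L" if "i \<in> I" for i
    using sq[OF that] subfield_Rats[OF L] by blast
  have nz: "r i \<noteq> 0" if "i \<in> I" for i
    using irr[of "{i}"] that by force
  have rj: "r j \<notin> ?L"
    using insert.IH[of "{j}"] insert by auto
  have U: "prod r U \<notin> ?L"
    using insert by auto
  have Uj: "prod r U * r j \<notin> ?L"
  proof -
    have "prod r (insert j U) \<notin> ?L"
      using insert by (intro insert.IH) auto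
    then show ?thesis
      using insert by (simp add: mult.commute)
  qed
  show ?case
  proof
    assume "prod r U \<in> complex_subfield hull (r ` insert j T)"
    then obtain a b where ab: "a \<in> ?L" "b \<in> ?L" "prod r U = a + b * r j"
      using insert.prems sqL hull_insert_sqrt[of "r j" "r ` T"] by auto
    have "(prod r U)\<^sup>2 \<in> ?L"
      unfolding prod_power_distrib
      using insert.prems(4) by (intro subfield_prod[OF L] sqL) blast
    moreover have "2 * a * b * r j = (prod r U)\<^sup>2 - a * a - b * b * (r j)\<^sup>2"
      unfolding ab(3) by (simp add: algebra_simps power2_eq_square)
    moreover have "(r j)\<^sup>2 \<in> ?L"
      using sqL insert.prems by simp
    ultimately have ab2: "2 * a * b * r j \<in> ?L"
      using ab by (auto intro!: subfield_diff[OF L] subfield_mult[OF L])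
    show False
    proof (cases "a = 0 \<or> b = 0")
      case True
      then show ?thesis
      proof
        assume "a = 0"
        then have "prod r U * r j = b * (r j)\<^sup>2"
          by (simp add: ab(3) power2_eq_square)
        then show False
          using Uj ab \<open>(r j)\<^sup>2 \<in> ?L\<close> by (auto intro: subfield_mult[OF L])
      next
        assume "b = 0"
        then show False using U ab by simp
      qed
    next
      case False
      have two: "2 \<in> ?L"
        using subfield_of_int[OF L, of 2] by simp
      have "r j = (2 * a * b * r j) / (2 * a * b)"
        using False by simp
      then show False
        using rj subfield_divide[OF L ab2 subfield_mult[OF L subfield_mult[OF L two ab(1)] ab(2)]]
        by simp
    qed
  qed
qed

section \<open>Automorphisms of a field generated by square roots\<close>

text \<open>The elements on which two automorphisms agree form a subfield.\<close>

lemma galois_group_unique_on_generators: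
  assumes "\<sigma> \<in> galois_group (complex_subfield hull S) F" "\<tau> \<in> galois_group (complex_subfield hull S) F"
    and agree: "\<And>x. x \<in> S \<Longrightarrow> \<sigma> x = \<tau> x"
  shows "\<sigma> = \<tau>"
proof -
  let ?K = "complex_subfield hull S"
  note K = complex_subfield_hull[of S]
  have hom: "\<rho> 1 = 1" "\<rho> (x - y) = \<rho> x - \<rho> y" "\<rho> (inverse x) = inverse (\<rho> x)"
    if \<rho>: "\<rho> \<in> galois_group ?K F" and xy: "x \<in> ?K" "y \<in> ?K" for \<rho> x y
  proof -
    have add: "\<rho> (u + v) = \<rho> u + \<rho> v" and mult: "\<rho> (u * v) = \<rho> u * \<rho> v"
      if "u \<in> ?K" "v \<in> ?K" for u v
      using \<rho> that by (auto simp: galois_group_def)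
    have inj: "inj_on \<rho> ?K"
      using \<rho> by (auto simp: galois_group_def bij_betw_def)
    have 0: "\<rho> 0 = 0"
      using add[OF subfield_zero[OF K] subfield_zero[OF K]] by simp
    have nz: "\<rho> u \<noteq> 0" if "u \<in> ?K" "u \<noteq> 0" for u
      using inj_onD[OF inj, of u 0] 0 that subfield_zero[OF K] by auto
    show 1: "\<rho> 1 = 1"
      using mult[OF subfield_one[OF K] subfield_one[OF K]] nz[OF subfield_one[OF K]] by simp
    show "\<rho> (x - y) = \<rho> x - \<rho> y"
      using add[OF subfield_diff[OF K xy] xy(2)] by simp
    show "\<rho> (inverse x) = inverse (\<rho> x)"
    proof (cases "x = 0")
      case False
      then show ?thesis
        using mult[OF xy(1) subfield_inverse[OF K xy(1)]] 1 inverse_unique[of "\<rho> x" "\<rho> (inverse x)"] by simp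
    qed (simp add: 0)
  qed
  have mult: "\<rho> (u * v) = \<rho> u * \<rho> v" if "\<rho> \<in> galois_group ?K F" "u \<in> ?K" "v \<in> ?K" for \<rho> u v
    using that by (auto simp: galois_group_def)
  have "complex_subfield {x \<in> ?K. \<sigma> x = \<tau> x}"
    by (rule complex_subfieldI)
      (simp_all add: hom(1)[OF assms(1) subfield_one[OF K] subfield_one[OF K]]
        hom(1)[OF assms(2) subfield_one[OF K] subfield_one[OF K]]
        hom(2)[OF assms(1)] hom(2)[OF assms(2)] hom(3)[OF assms(1) _ subfield_one[OF K]]
        hom(3)[OF assms(2) _ subfield_one[OF K]] mult[OF assms(1)] mult[OF assms(2)]
        subfield_one[OF K] subfield_diff[OF K] subfield_mult[OF K] subfield_inverse[OF K])
  then have "?K \<subseteq> {x \<in> ?K. \<sigma> x = \<tau> x}"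
    using agree by (intro hull_minimal) (auto intro: hull_inc)
  moreover have "\<sigma> \<in> extensional ?K" "\<tau> \<in> extensional ?K"
    using assms by (auto simp: galois_group_def)
  ultimately show ?thesis
    by (auto intro: extensionalityI)
qed

lemma quadratic_conjugation_exists:
  assumes L: "complex_subfield L" and c: "c\<^sup>2 \<in> L" "c \<notin> L"
  defines "K \<equiv> {a + b * c |a b. a \<in> L \<and> b \<in> L}"
  obtains \<sigma> where "\<sigma> \<in> galois_group K \<rat>" "\<sigma> c = - c" "\<And>a. a \<in> L \<Longrightarrow> \<sigma> a = a"
proof -
  note closed = subfield_diff[OF L] subfield_mult[OF L] subfield_add[OF L] subfield_uminus[OF L]
    subfield_divide[OF L] c(1)
  have unique: "a = a' \<and> b = b'"
    if "a + b * c = a' + b' * c" "a \<in> L" "b \<in> L" "a' \<in> L" "b' \<in> L" for a b a' b'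
  proof (rule ccontr)
    assume *: "\<not> (a = a' \<and> b = b')"
    then have "b \<noteq> b'" using that(1) by auto
    moreover have "c * (b - b') = a' - a"
      using that(1) by (simp add: algebra_simps)
    ultimately have "c = (a' - a) / (b - b')"
      by (simp add: field_simps)
    then show False
      using c(2) closed(5)[OF closed(1)[OF that(4,2)] closed(1)[OF that(3,5)]] by simp
  qed
  define \<sigma> where "\<sigma> = restrict (\<lambda>z. THE w. \<exists>a\<in>L. \<exists>b\<in>L. z = a + b * c \<and> w = a - b * c) K"
  have K: "a + b * c \<in> K" "a - b * c \<in> K" if "a \<in> L" "b \<in> L" for a b
  proof -
    show "a + b * c \<in> K"
      using that by (auto simp: K_def)
    have *: "a - b * c = a + (- b) * c" by simp
    show "a - b * c \<in> K"
      unfolding K_def * using that(1) closed(4)[OF that(2)] by blast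
  qed
  have eval: "\<sigma> (a + b * c) = a - b * c" if "a \<in> L" "b \<in> L" for a b
  proof -
    have "(THE w. \<exists>a'\<in>L. \<exists>b'\<in>L. a + b * c = a' + b' * c \<and> w = a' - b' * c) = a - b * c"
    proof (rule the_equality)
      fix w assume "\<exists>a'\<in>L. \<exists>b'\<in>L. a + b * c = a' + b' * c \<and> w = a' - b' * c"
      then obtain a' b' where w: "a' \<in> L" "b' \<in> L" "a + b * c = a' + b' * c" "w = a' - b' * c"
        by blast
      then show "w = a - b * c"
        using unique[OF w(3) that w(1,2)] by simp
    qed (use that in blast)
    then show ?thesis
      using K[OF that] by (simp add: \<sigma>_def)
  qed
  have eval': "\<sigma> (a - b * c) = a + b * c" if "a \<in> L" "b \<in> L" for a b
    using eval[OF that(1) closed(4)[OF that(2)]] by simp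
  have invol: "\<sigma> z \<in> K" "\<sigma> (\<sigma> z) = z" if z: "z \<in> K" for z
  proof -
    obtain a b where "a \<in> L" "b \<in> L" "z = a + b * c"
      using z unfolding K_def by blast
    then show "\<sigma> z \<in> K" "\<sigma> (\<sigma> z) = z"
      by (simp_all add: eval eval' K)
  qed
  have fix_L: "\<sigma> a = a" if "a \<in> L" for a
    using eval[OF that subfield_zero[OF L]] by simp
  have hom: "\<sigma> (x + y) = \<sigma> x + \<sigma> y \<and> \<sigma> (x * y) = \<sigma> x * \<sigma> y" if xy: "x \<in> K" "y \<in> K" for x y
  proof -
    obtain a b a' b' where ab: "a \<in> L" "b \<in> L" "a' \<in> L" "b' \<in> L" "x = a + b * c" "y = a' + b' * c"
      using xy unfolding K_def by blast
    have "\<sigma> (x + y) = \<sigma> ((a + a') + (b + b') * c)"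
      by (simp add: ab algebra_simps)
    also have "\<dots> = (a + a') - (b + b') * c"
      by (intro eval closed ab)
    finally have 1: "\<sigma> (x + y) = \<sigma> x + \<sigma> y"
      using ab by (simp add: eval algebra_simps)
    have "\<sigma> (x * y) = \<sigma> ((a * a' + b * b' * c\<^sup>2) + (a * b' + b * a') * c)"
      by (simp add: ab algebra_simps power2_eq_square)
    also have "\<dots> = (a * a' + b * b' * c\<^sup>2) - (a * b' + b * a') * c"
      by (intro eval closed ab)
    also have "\<dots> = (a - b * c) * (a' - b' * c)"
      by (simp add: algebra_simps power2_eq_square)
    finally show ?thesis
      using 1 ab by (simp add: eval)
  qed
  have "bij_betw \<sigma> K K"
    using invol by (intro bij_betw_byWitness[where f' = \<sigma>]) auto
  moreover have "\<sigma> \<in> extensional K"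
    by (simp add: \<sigma>_def)
  ultimately have "\<sigma> \<in> galois_group K \<rat>"
    using hom fix_L subfield_Rats[OF L] by (auto simp: galois_group_def)
  moreover have "\<sigma> c = - c"
    using eval[OF subfield_zero[OF L] subfield_one[OF L]] by simp
  ultimately show ?thesis
    using fix_L by (rule that)
qed

text \<open>The field \<open>KG t r\<close> is a quadratic extension, by \<open>r j\<close>, of the field generated by the other square roots;
its conjugation is the required automorphism.\<close>

lemma tau_characterization:
  assumes sq: "\<And>i. i \<in> {1..t} \<Longrightarrow> (r i)\<^sup>2 \<in> \<rat>"
    and irr: "\<And>U. U \<noteq> {} \<Longrightarrow> U \<subseteq> {1..t} \<Longrightarrow> prod r U \<notin> \<rat>"
    and j: "j \<in> {1..t}"
  shows "tau t r j \<in> galois_group (KG t r) \<rat>" "tau t r j (r j) = - r j"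
    "\<And>i. i \<in> {1..t} \<Longrightarrow> i \<noteq> j \<Longrightarrow> tau t r j (r i) = r i"
proof -
  let ?L = "complex_subfield hull (r ` ({1..t} - {j}))"
  note L = complex_subfield_hull[of "r ` ({1..t} - {j})"]
  have "r j \<notin> ?L"
    using prod_sqrts_notin_hull[of "{1..t}" r "{1..t} - {j}" "{j}"] sq irr j by auto
  moreover have sqL: "(r j)\<^sup>2 \<in> ?L"
    using sq[OF j] subfield_Rats[OF L] by blast
  ultimately obtain \<sigma> where \<sigma>: "\<sigma> \<in> galois_group {a + b * r j |a b. a \<in> ?L \<and> b \<in> ?L} \<rat>"
    "\<sigma> (r j) = - r j" "\<And>a. a \<in> ?L \<Longrightarrow> \<sigma> a = a"
    using quadratic_conjugation_exists[OF L] by blast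
  have "insert (r j) (r ` ({1..t} - {j})) = r ` {1..t}"
    using j by auto
  then have K: "{a + b * r j |a b. a \<in> ?L \<and> b \<in> ?L} = KG t r"
    using hull_insert_sqrt[OF sqL] by (simp add: KG_def)
  let ?P = "\<lambda>\<sigma>. \<sigma> \<in> galois_group (KG t r) \<rat> \<and> \<sigma> (r j) = - r j \<and>
     (\<forall>i\<in>{1..t} - {j}. \<sigma> (r i) = r i)"
  have "?P \<sigma>"
    using \<sigma> unfolding K by (auto intro: hull_inc)
  moreover have "\<rho> = \<sigma>" if "?P \<rho>" for \<rho>
    unfolding KG_def
  proof (rule galois_group_unique_on_generators[of \<rho> "r ` {1..t}" \<rat> \<sigma>])
    fix x assume "x \<in> r ` {1..t}"
    then obtain i where "i \<in> {1..t}" "x = r i" by auto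
    then show "\<rho> x = \<sigma> x"
      using \<open>?P \<rho>\<close> \<open>?P \<sigma>\<close> by (cases "i = j") auto
  qed (use \<open>?P \<rho>\<close> \<open>?P \<sigma>\<close> in \<open>simp_all add: KG_def\<close>)
  ultimately have "?P (tau t r j)"
    unfolding tau_def by (intro theI[of ?P]) auto
  then show "tau t r j \<in> galois_group (KG t r) \<rat>" "tau t r j (r j) = - r j"
    "\<And>i. i \<in> {1..t} \<Longrightarrow> i \<noteq> j \<Longrightarrow> tau t r j (r i) = r i"
    by auto
qed

text \<open>The maps \<open>tau_prod t r l\<close> are composites with the identity on all complex numbers, so they need not be
extensional and may lie outside \<open>galois_group\<close>.  Being a ring homomorphism of \<open>K\<close>
into itself is closed under composition and suffices for all computations.\<close>

definition subfield_endo :: "complex set \<Rightarrow> (complex \<Rightarrow> complex) \<Rightarrow> bool" where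
  "subfield_endo K \<sigma> \<longleftrightarrow> \<sigma> ` K \<subseteq> K \<and> \<sigma> 1 = 1 \<and>
     (\<forall>x\<in>K. \<forall>y\<in>K. \<sigma> (x + y) = \<sigma> x + \<sigma> y \<and> \<sigma> (x * y) = \<sigma> x * \<sigma> y)"

lemma subfield_endoD:
  assumes "subfield_endo K \<sigma>"
  shows "\<And>x. x \<in> K \<Longrightarrow> \<sigma> x \<in> K" "\<sigma> 1 = 1"
    "\<And>x y. x \<in> K \<Longrightarrow> y \<in> K \<Longrightarrow> \<sigma> (x + y) = \<sigma> x + \<sigma> y"
    "\<And>x y. x \<in> K \<Longrightarrow> y \<in> K \<Longrightarrow> \<sigma> (x * y) = \<sigma> x * \<sigma> y"
  using assms by (auto simp: subfield_endo_def)

lemma galois_group_imp_endo: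
  "complex_subfield K \<Longrightarrow> \<sigma> \<in> galois_group K \<rat> \<Longrightarrow> subfield_endo K \<sigma>"
  by (auto simp: galois_group_def subfield_endo_def bij_betw_def)

lemma subfield_endo_id: "subfield_endo K id"
  by (simp add: subfield_endo_def)

lemma subfield_endo_comp:
  "subfield_endo K \<sigma> \<Longrightarrow> subfield_endo K \<tau> \<Longrightarrow> subfield_endo K (\<sigma> \<circ> \<tau>)"
  by (auto simp: subfield_endo_def image_subset_iff)

lemma subfield_endo_funpow: "subfield_endo K \<sigma> \<Longrightarrow> subfield_endo K (\<sigma> ^^ n)"
  by (induction n) (simp_all add: subfield_endo_id subfield_endo_comp)

context
  fixes K \<sigma>
  assumes K: "complex_subfield K" and \<sigma>: "subfield_endo K \<sigma>"
begin

lemma endo_zero: "\<sigma> 0 = 0"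
  using subfield_endoD(3)[OF \<sigma> subfield_zero[OF K] subfield_zero[OF K]] by simp

lemma endo_diff:
  assumes "x \<in> K" "y \<in> K"
  shows "\<sigma> (x - y) = \<sigma> x - \<sigma> y"
  using subfield_endoD(3)[OF \<sigma> subfield_diff[OF K assms] assms(2)] by simp

lemma endo_uminus:
  assumes "x \<in> K"
  shows "\<sigma> (- x) = - \<sigma> x"
  using endo_diff[OF subfield_zero[OF K] assms] by (simp add: endo_zero)

lemma endo_of_int: "\<sigma> (of_int n) = of_int n"
proof (induction n rule: int_induct[where k = 0])
  case (step1 i)
  then show ?case
    using subfield_endoD(2,3)[OF \<sigma>] subfield_one[OF K] subfield_of_int[OF K] by simp
next
  case (step2 i)
  then show ?case
    using subfield_endoD(2)[OF \<sigma>] endo_diff subfield_one[OF K] subfield_of_int[OF K] by simp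
qed (simp add: endo_zero)

lemma endo_of_rat: "\<sigma> (of_rat c) = of_rat c"
proof -
  obtain a b where ab: "c = of_int a / of_int b" "b \<noteq> 0"
    by (metis Fract_of_int_quotient Rat_cases less_irrefl)
  have "of_rat c \<in> K"
    using subfield_Rats[OF K] by auto
  then have "\<sigma> (of_rat c * of_int b) = \<sigma> (of_rat c) * of_int b"
    using subfield_endoD(4)[OF \<sigma>] subfield_of_int[OF K] endo_of_int by simp
  moreover have "of_rat c * of_int b = (of_int a :: complex)"
    using ab by (simp add: of_rat_divide)
  ultimately have "\<sigma> (of_rat c) * of_int b = of_rat c * of_int b"
    using endo_of_int by metis
  moreover have "(of_int b :: complex) \<noteq> 0"
    using ab(2) by simp
  ultimately show ?thesis
    using mult_right_cancel by blast
qed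

lemma endo_sum: "(\<And>i. i \<in> A \<Longrightarrow> f i \<in> K) \<Longrightarrow> \<sigma> (sum f A) = (\<Sum>i\<in>A. \<sigma> (f i))"
  by (induction A rule: infinite_finite_induct)
    (auto simp: endo_zero subfield_endoD(3)[OF \<sigma>] subfield_sum[OF K])

lemma endo_prod: "(\<And>i. i \<in> A \<Longrightarrow> f i \<in> K) \<Longrightarrow> \<sigma> (prod f A) = (\<Prod>i\<in>A. \<sigma> (f i))"
  by (induction A rule: infinite_finite_induct)
    (auto simp: subfield_endoD(2,4)[OF \<sigma>] subfield_prod[OF K])

lemma endo_algebraic_int:
  assumes x: "x \<in> K" "algebraic_int x"
  shows "algebraic_int (\<sigma> x)"
proof -
  have "poly (map_poly of_int p) x \<in> K \<and>
    \<sigma> (poly (map_poly of_int p) x) = poly (map_poly of_int p) (\<sigma> x)" for p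
  proof (induction p)
    case 0
    then show ?case by (simp add: endo_zero subfield_zero[OF K])
  next
    case (pCons a p)
    then show ?case
      using x(1) by (simp add: map_poly_pCons endo_of_int subfield_of_int[OF K]
          subfield_endoD(3,4)[OF \<sigma>] subfield_add[OF K] subfield_mult[OF K])
  qed
  then show ?thesis
    using x(2) endo_zero unfolding algebraic_int_altdef_ipoly by metis
qed

end

lemma tau_prod_endo:
  assumes sq: "\<And>i. i \<in> {1..t} \<Longrightarrow> (r i)\<^sup>2 \<in> \<rat>"
    and irr: "\<And>U. U \<noteq> {} \<Longrightarrow> U \<subseteq> {1..t} \<Longrightarrow> prod r U \<notin> \<rat>"
  shows tau_prod_is_endo: "subfield_endo (KG t r) (tau_prod t r l)"
    and tau_prod_generator: "i \<in> {1..t} \<Longrightarrow>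
      tau_prod t r l (r i) = (if i < t then (-1) ^ l i else 1) * r i"
proof -
  let ?K = "KG t r"
  have K: "complex_subfield ?K"
    by (simp add: KG_def complex_subfield_hull)
  have rK: "r i \<in> ?K" if "i \<in> {1..t}" for i
    using that by (auto simp: KG_def intro: hull_inc)
  have tau: "tau t r j \<in> galois_group (KG t r) \<rat>" "tau t r j (r j) = - r j"
    "\<And>i. i \<in> {1..t} \<Longrightarrow> i \<noteq> j \<Longrightarrow> tau t r j (r i) = r i" if "j \<in> {1..t}" for j
    using tau_characterization[of t r j] sq irr that by simp_all
  have endo_tau: "subfield_endo ?K (tau t r j ^^ n)" if "j \<in> {1..t}" for j n
    using tau(1) K that by (intro subfield_endo_funpow galois_group_imp_endo)
  have pow: "(tau t r j ^^ n) (r i) = (if i = j then (-1) ^ n else 1) * r i"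
    if ij: "i \<in> {1..t}" "j \<in> {1..t}" for i j n
  proof (induction n)
    case (Suc n)
    have "tau t r j (- r i) = - tau t r j (r i)"
      using endo_uminus[OF K galois_group_imp_endo[OF K tau(1)[OF ij(2)]] rK[OF ij(1)]] .
    then show ?case
      using Suc tau(2)[OF ij(2)] tau(3)[OF ij(2) ij(1)] by (cases "i = j"; cases "even n") auto
  qed simp
  define F where "F xs = foldr (\<lambda>j f. (tau t r j ^^ l j) \<circ> f) xs id" for xs
  have F: "F [] = id" "F (j # xs) = (tau t r j ^^ l j) \<circ> F xs" for j xs
    by (simp_all add: F_def)
  have fold: "subfield_endo ?K (F xs) \<and>
    (\<forall>i\<in>{1..t}. F xs (r i) = (if i \<in> set xs then (-1) ^ l i else 1) * r i)"
    if "distinct xs" "set xs \<subseteq> {1..t}" for xs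
    using that
  proof (induction xs)
    case Nil
    show ?case
      unfolding F(1) by (intro conjI ballI subfield_endo_id) simp
  next
    case (Cons j xs)
    have j: "j \<in> {1..t}" using Cons by simp
    have "F (j # xs) (r i) = (if i \<in> set (j # xs) then (-1) ^ l i else 1) * r i"
      if i: "i \<in> {1..t}" for i
    proof -
      have IH: "F xs (r i) = (if i \<in> set xs then (-1) ^ l i else 1) * r i"
        using Cons i by simp
      have neg: "(tau t r j ^^ l j) (- r i) = - (tau t r j ^^ l j) (r i)"
        using endo_uminus[OF K endo_tau[OF j] rK[OF i]] .
      show ?thesis
        unfolding F(2) o_apply IH
        using Cons.prems pow[OF i j] neg by (cases "even (l i)") auto
    qed
    moreover have "subfield_endo ?K (F (j # xs))"
      unfolding F(2) using Cons by (intro subfield_endo_comp endo_tau[OF j]) auto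
    ultimately show ?case by blast
  qed
  have "distinct [1..<t]" "set [1..<t] \<subseteq> {1..t}" by auto
  from fold[OF this] show "subfield_endo ?K (tau_prod t r l)"
    "i \<in> {1..t} \<Longrightarrow> tau_prod t r l (r i) = (if i < t then (-1) ^ l i else 1) * r i"
    by (auto simp: tau_prod_def F_def)
qed

section \<open>The two families as sums and differences of conjugates\<close>

text \<open>Only the parity of the index matters.  Indexing by natural numbers lets a conjugation act as an
addition to the index.\<close>

definition alpha_conj :: "(nat \<Rightarrow> complex) \<Rightarrow> nat \<Rightarrow> nat \<Rightarrow> complex" where
  "alpha_conj r i n = (1 + (-1) ^ n * r i) / 2"

lemma alpha_conj_0: "alpha_conj r i 0 = alpha r i"
  and alpha_conj_1: "alpha_conj r i (Suc 0) = alpha_tilde r i"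
  by (simp_all add: alpha_conj_def alpha_def alpha_tilde_def)

lemma alpha_conj_cong: "even (m + n) \<Longrightarrow> alpha_conj r i m = alpha_conj r i n"
  by (cases "even m") (auto simp: alpha_conj_def)

text \<open>The shift of the \<open>i\<close>-th index caused by \<open>e\<close> complex conjugations, which affect only the square roots of
negative numbers.\<close>

definition flip :: "nat \<Rightarrow> nat \<Rightarrow> nat \<Rightarrow> nat" where
  "flip u i e = (if u < i then e else 0)"

text \<open>For \<open>e = 0\<close> and \<open>e = 1\<close> these are the two summands of \<open>beta t u r s\<close>, which are complex conjugates
of each other when conjugation negates exactly the \<open>r i\<close> with \<open>i > u\<close>.\<close>

definition half_beta :: "nat \<Rightarrow> nat \<Rightarrow> (nat \<Rightarrow> complex) \<Rightarrow> (nat \<Rightarrow> nat) \<Rightarrow> nat \<Rightarrow> complex" where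
  "half_beta t u r s e = alpha_conj r t e * (\<Prod>i=1..t-1. alpha_conj r i (s i + flip u i e))"

lemma prod_split_at:
  fixes f g :: "nat \<Rightarrow> complex"
  assumes "u \<le> t - (1::nat)"
  shows "(\<Prod>i=1..t-1. if u < i then f i else g i) = (\<Prod>i=1..u. g i) * (\<Prod>i=u+1..t-1. f i)"
proof -
  have "{1..t-1} = {1..u} \<union> {u+1..t-1}"
    using assms by auto
  then have "(\<Prod>i=1..t-1. if u < i then f i else g i) =
      (\<Prod>i=1..u. if u < i then f i else g i) * (\<Prod>i=u+1..t-1. if u < i then f i else g i)"
    by (simp add: prod.union_disjoint)
  then show ?thesis by simp
qed

lemma bits_cases: "s \<in> bits t \<Longrightarrow> i \<in> {1..t-1} \<Longrightarrow> s i = 0 \<or> s i = 1"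
  by (auto simp: bits_def)

lemma finite_bits: "finite (bits t)"
  by (simp add: bits_def finite_PiE)

lemma half_beta_split:
  assumes "u \<le> t - 1"
  shows "half_beta t u r s e = alpha_conj r t e *
    ((\<Prod>i=1..u. alpha_conj r i (s i)) * (\<Prod>i=u+1..t-1. alpha_conj r i (s i + e)))"
  using prod_split_at[OF assms, of "\<lambda>i. alpha_conj r i (s i + e)" "\<lambda>i. alpha_conj r i (s i)"]
  by (simp add: half_beta_def flip_def if_distrib cong: if_cong)

lemma beta_eq_half_beta:
  assumes "s \<in> bits t" "u \<le> t - 1"
  shows "beta t u r s = half_beta t u r s 0 + half_beta t u r s 1"
proof -
  have f: "alpha_tilde r i ^ s i * alpha r i ^ (1 - s i) = alpha_conj r i (s i)"
    "alpha_tilde r i ^ (1 - s i) * alpha r i ^ s i = alpha_conj r i (s i + 1)" if "i \<in> {1..t-1}" for i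
    using bits_cases[OF assms(1) that] alpha_conj_cong[of 2 0]
    by (auto simp: alpha_conj_0 alpha_conj_1 numeral_2_eq_2)
  have "beta t u r s = (\<Prod>i=1..u. alpha_conj r i (s i)) *
      ((\<Prod>i=u+1..t-1. alpha_conj r i (s i)) * alpha r t +
       (\<Prod>i=u+1..t-1. alpha_conj r i (s i + 1)) * alpha_tilde r t)"
  proof -
    have "(\<Prod>i=1..u. alpha_tilde r i ^ s i * alpha r i ^ (1 - s i)) = (\<Prod>i=1..u. alpha_conj r i (s i))"
      using assms(2) by (intro prod.cong refl f) auto
    moreover have "(\<Prod>i=u+1..t-1. alpha_tilde r i ^ s i * alpha r i ^ (1 - s i)) =
        (\<Prod>i=u+1..t-1. alpha_conj r i (s i))"
      by (intro prod.cong refl f) auto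
    moreover have "(\<Prod>i=u+1..t-1. alpha_tilde r i ^ (1 - s i) * alpha r i ^ s i) =
        (\<Prod>i=u+1..t-1. alpha_conj r i (s i + 1))"
      by (intro prod.cong refl f) auto
    ultimately show ?thesis
      by (simp only: beta_def)
  qed
  then show ?thesis
    unfolding half_beta_split[OF assms(2)] by (simp add: alpha_conj_0 alpha_conj_1 algebra_simps)
qed

lemma beta_star_eq_half_beta:
  assumes "s \<in> bits t" "u \<le> t - 1"
  shows "beta_star t u r s =
    (-1) ^ (\<Sum>i=1..t-1. s i) * (half_beta t u r s 0 - half_beta t u r s 1)"
proof -
  have f: "(- alpha_tilde r i) ^ s i * alpha r i ^ (1 - s i) = (-1) ^ s i * alpha_conj r i (s i)"
    "alpha_tilde r i ^ (1 - s i) * (- alpha r i) ^ s i = (-1) ^ s i * alpha_conj r i (s i + 1)"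
    if "i \<in> {1..t-1}" for i
    using bits_cases[OF assms(1) that] alpha_conj_cong[of 2 0]
    by (auto simp: alpha_conj_0 alpha_conj_1 numeral_2_eq_2)
  have sgn: "(-1) ^ (\<Sum>i=1..t-1. s i) =
      (\<Prod>i=1..u. (-1) ^ s i) * (\<Prod>i=u+1..t-1. (-1 :: complex) ^ s i)"
    using prod_split_at[OF assms(2), of "\<lambda>i. (-1) ^ s i" "\<lambda>i. (-1) ^ s i"]
    by (simp add: power_sum)
  have "beta_star t u r s = (\<Prod>i=1..u. (-1) ^ s i * alpha_conj r i (s i)) *
      ((\<Prod>i=u+1..t-1. (-1) ^ s i * alpha_conj r i (s i)) * alpha r t -
       (\<Prod>i=u+1..t-1. (-1) ^ s i * alpha_conj r i (s i + 1)) * alpha_tilde r t)"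
  proof -
    have "(\<Prod>i=1..u. (- alpha_tilde r i) ^ s i * alpha r i ^ (1 - s i)) =
        (\<Prod>i=1..u. (-1) ^ s i * alpha_conj r i (s i))"
      using assms(2) by (intro prod.cong refl f) auto
    moreover have "(\<Prod>i=u+1..t-1. (- alpha_tilde r i) ^ s i * alpha r i ^ (1 - s i)) =
        (\<Prod>i=u+1..t-1. (-1) ^ s i * alpha_conj r i (s i))"
      by (intro prod.cong refl f) auto
    moreover have "(\<Prod>i=u+1..t-1. alpha_tilde r i ^ (1 - s i) * (- alpha r i) ^ s i) =
        (\<Prod>i=u+1..t-1. (-1) ^ s i * alpha_conj r i (s i + 1))"
      by (intro prod.cong refl f) auto
    ultimately show ?thesis
      by (simp only: beta_star_def)
  qed
  then show ?thesis
    unfolding sgn half_beta_split[OF assms(2)] prod.distrib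
    by (simp add: alpha_conj_0 alpha_conj_1 algebra_simps)
qed

section \<open>Duality under the signed trace\<close>

text \<open>The images of the square roots under \<open>tau_prod t r \<mu>\<close>, as a new choice of square roots.\<close>

definition twist :: "nat \<Rightarrow> (nat \<Rightarrow> nat) \<Rightarrow> (nat \<Rightarrow> complex) \<Rightarrow> nat \<Rightarrow> complex" where
  "twist t \<mu> r i = (if i < t then (-1) ^ \<mu> i else 1) * r i"

lemma alpha_conj_signed_sum:
  "(\<Sum>m\<in>{0, 1}. (-1) ^ m * (alpha_conj r i (k + m) * alpha_conj r i (l + m))) =
    (if even (k + l) then (-1) ^ k * r i else 0)"
  by (cases "even k"; cases "even l") (auto simp: alpha_conj_def field_simps)

text \<open>Each summand is a product over \<open>i\<close> whose \<open>i\<close>-th factor depends on \<open>\<mu> i\<close> alone, so the sum over all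
\<open>\<mu>\<close> is a product of sums with two terms each.\<close>

lemma half_beta_pairing:
  shows "(\<Sum>\<mu>\<in>bits t. (-1) ^ (\<Sum>j=1..t-1. \<mu> j) *
      (half_beta t u (twist t \<mu> r) \<eta> e * half_beta t u (twist t \<mu> r) \<nu> e')) =
    alpha_conj r t e * alpha_conj r t e' *
      (\<Prod>i=1..t-1. if even (\<eta> i + \<nu> i + flip u i (e + e'))
        then (-1) ^ (\<eta> i + flip u i e) * r i else 0)"
proof -
  let ?f = "\<lambda>i m. (-1) ^ m *
    (alpha_conj r i (\<eta> i + flip u i e + m) * alpha_conj r i (\<nu> i + flip u i e' + m))"
  have tw: "alpha_conj (twist t \<mu> r) i n = alpha_conj r i (n + \<mu> i)" if "i \<in> {1..t-1}" for \<mu> i n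
  proof -
    have "i < t" using that by auto
    then show ?thesis by (simp add: alpha_conj_def twist_def power_add)
  qed
  have twt: "alpha_conj (twist t \<mu> r) t n = alpha_conj r t n" for \<mu> n
    by (simp add: alpha_conj_def twist_def)
  have "(-1) ^ (\<Sum>j=1..t-1. \<mu> j) *
      (half_beta t u (twist t \<mu> r) \<eta> e * half_beta t u (twist t \<mu> r) \<nu> e') =
      alpha_conj r t e * alpha_conj r t e' * (\<Prod>i=1..t-1. ?f i (\<mu> i))" for \<mu>
    by (simp add: half_beta_def tw twt power_sum prod.distrib mult_ac)
  then have "(\<Sum>\<mu>\<in>bits t. (-1) ^ (\<Sum>j=1..t-1. \<mu> j) *
      (half_beta t u (twist t \<mu> r) \<eta> e * half_beta t u (twist t \<mu> r) \<nu> e')) =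
      alpha_conj r t e * alpha_conj r t e' * (\<Sum>\<mu>\<in>bits t. \<Prod>i=1..t-1. ?f i (\<mu> i))"
    by (simp only: sum_distrib_left)
  also have "(\<Sum>\<mu>\<in>bits t. \<Prod>i=1..t-1. ?f i (\<mu> i)) = (\<Prod>i=1..t-1. \<Sum>m\<in>{0, 1}. ?f i m)"
    unfolding bits_def by (rule prod_sum_PiE[symmetric]) auto
  also have "\<dots> = (\<Prod>i=1..t-1. if even (\<eta> i + \<nu> i + flip u i (e + e'))
        then (-1) ^ (\<eta> i + flip u i e) * r i else 0)"
    unfolding alpha_conj_signed_sum by (intro prod.cong) (auto simp: flip_def)
  finally show ?thesis .
qed

text \<open>In the pairings of the halves \<open>(e, e')\<close> and \<open>(1 - e, 1 - e')\<close>, the products over \<open>i\<close> differ by a sign for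
each \<open>i\<close> with \<open>u < i < t\<close>, and the number of these \<open>i\<close> is even.  Hence the mixed terms cancel, and the remaining ones leave
the factor \<open>\<alpha>\<^sub>t\<^sup>2 - \<alpha>'\<^sub>t\<^sup>2 = r\<^sub>t\<close>, where \<open>\<alpha>'\<^sub>t\<close> is the conjugate of \<open>\<alpha>\<^sub>t\<close>.\<close>

lemma beta_duality:
  assumes "t \<ge> 1" "u \<le> t - 1" "odd (t - u)" and \<eta>: "\<eta> \<in> bits t" and \<nu>: "\<nu> \<in> bits t"
  shows "(\<Sum>\<mu>\<in>bits t. (-1) ^ (\<Sum>j=1..t-1. \<mu> j) *
      (beta t u (twist t \<mu> r) \<eta> * beta_star t u (twist t \<mu> r) \<nu>)) =
    (if \<eta> = \<nu> then \<Prod>i=1..t. r i else 0)"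
proof -
  define P where "P e e' = (\<Prod>i=1..t-1. if even (\<eta> i + \<nu> i + flip u i (e + e'))
        then (-1) ^ (\<eta> i + flip u i e) * r i else 0)" for e e'
  define S where "S e e' = (\<Sum>\<mu>\<in>bits t. (-1) ^ (\<Sum>j=1..t-1. \<mu> j) *
      (half_beta t u (twist t \<mu> r) \<eta> e * half_beta t u (twist t \<mu> r) \<nu> e'))" for e e'
  have S: "S e e' = alpha_conj r t e * alpha_conj r t e' * P e e'" for e e'
    unfolding S_def P_def by (rule half_beta_pairing)
  have sgn: "(\<Prod>i=1..t-1. if u < i then -1 else (1::complex)) = 1"
  proof -
    have "even (t - 1 - u)"
      using assms(1-3) by auto
    then show ?thesis
      unfolding prod_split_at[OF assms(2)] by simp
  qed
  have P_shift: "P f f' = P e e'" if "f = e + 1" "f' + 1 = e' \<or> f' = e' + 1" for e e' f f'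
  proof -
    have "P f f' = P e e' * (\<Prod>i=1..t-1. if u < i then -1 else 1)"
      unfolding P_def prod.distrib[symmetric]
      using that by (intro prod.cong) (auto simp: flip_def)
    then show ?thesis by (simp only: sgn mult_1_right)
  qed
  have P00: "P 0 0 = (if \<eta> = \<nu> then (-1) ^ (\<Sum>i=1..t-1. \<nu> i) * (\<Prod>i=1..t-1. r i) else 0)"
  proof (cases "\<eta> = \<nu>")
    case True
    then show ?thesis
      by (simp add: P_def flip_def power_sum prod.distrib)
  next
    case False
    then obtain i where i: "i \<in> {1..t-1}" "\<eta> i \<noteq> \<nu> i"
      using \<eta> \<nu> unfolding bits_def by (metis PiE_ext)
    then have "odd (\<eta> i + \<nu> i)"
      using bits_cases[OF \<eta> i(1)] bits_cases[OF \<nu> i(1)] by auto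
    then have "P 0 0 = 0"
      unfolding P_def using i(1) by (intro prod_zero bexI[of _ i]) (auto simp: flip_def)
    then show ?thesis using False by simp
  qed
  let ?sg = "(-1) ^ (\<Sum>i=1..t-1. \<nu> i) :: complex"
  have "(\<Sum>\<mu>\<in>bits t. (-1) ^ (\<Sum>j=1..t-1. \<mu> j) *
      (beta t u (twist t \<mu> r) \<eta> * beta_star t u (twist t \<mu> r) \<nu>)) =
    ?sg * (S 0 0 - S 0 1 + S 1 0 - S 1 1)"
    unfolding S_def beta_eq_half_beta[OF \<eta> assms(2)] beta_star_eq_half_beta[OF \<nu> assms(2)]
      sum_subtractf[symmetric] sum.distrib[symmetric] sum_distrib_left
    by (intro sum.cong) (simp_all add: algebra_simps)
  also have "\<dots> = ?sg * P 0 0 * (alpha_conj r t 0 * alpha_conj r t 0 - alpha_conj r t 1 * alpha_conj r t 1)"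
  proof -
    have "P 1 0 = P 0 1" "P 1 1 = P 0 0"
      by (rule P_shift; simp)+
    then show ?thesis
      unfolding S by (simp only: algebra_simps)
  qed
  also have "alpha_conj r t 0 * alpha_conj r t 0 - alpha_conj r t 1 * alpha_conj r t 1 = r t"
    by (simp add: alpha_conj_def field_simps)
  also have "?sg * P 0 0 * r t = (if \<eta> = \<nu> then \<Prod>i=1..t. r i else 0)"
  proof -
    obtain n where "t = Suc n"
      using assms(1) by (cases t) auto
    then show ?thesis
      by (simp add: P00 power_add[symmetric] flip: mult.assoc)
  qed
  finally show ?thesis .
qed

section \<open>Rational spans of the two families\<close>

text \<open>Over a field that contains \<open>r\<^sup>2\<close>, both \<open>1\<close> and \<open>r\<close> are combinations of \<open>(1 + r) / 2\<close> and \<open>(1 - r) / 2\<close>,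
so each adjunction of a square root multiplies a spanning family by these two elements.\<close>

lemma hull_sqrts_subset_span:
  fixes r :: "nat \<Rightarrow> complex"
  assumes "finite T" "\<And>i. i \<in> T \<Longrightarrow> (r i)\<^sup>2 \<in> \<rat>"
  shows "complex_subfield hull (r ` T) \<subseteq>
    rat_complex.span (range (\<lambda>s. \<Prod>i\<in>T. alpha_conj r i (s i)))"
  using assms
proof (induction T rule: finite_induct)
  case empty
  have "complex_subfield hull {} \<subseteq> \<rat>"
    by (rule hull_minimal) (auto simp: complex_subfield_Rats)
  moreover have "\<rat> \<subseteq> rat_complex.span {1}"
  proof
    fix x :: complex assume "x \<in> \<rat>"
    then obtain c where "x = of_rat c" by (auto elim: Rats_cases)
    then show "x \<in> rat_complex.span {1}"
      using rat_complex.span_scale[OF rat_complex.span_base[of 1 "{1}"], of c] by simp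
  qed
  ultimately show ?case
    by simp
next
  case (insert j T)
  let ?L = "complex_subfield hull (r ` T)"
  let ?S = "\<lambda>T. rat_complex.span (range (\<lambda>s. \<Prod>i\<in>T. alpha_conj r i (s i)))"
  note L = complex_subfield_hull[of "r ` T"]
  have mult: "w * alpha_conj r j e \<in> ?S (insert j T)" if "w \<in> ?L" for w e
  proof -
    have "w \<in> ?S T"
      using that insert by auto
    then show ?thesis
    proof (induction rule: rat_complex.span_induct_alt)
      case base
      then show ?case by (simp add: rat_complex.span_zero)
    next
      case (step c b w)
      obtain s where "b = (\<Prod>i\<in>T. alpha_conj r i (s i))"
        using step(1) by auto
      then have "b * alpha_conj r j e = (\<Prod>i\<in>insert j T. alpha_conj r i ((s(j := e)) i))"
        using insert.hyps by (auto simp: mult.commute intro!: prod.cong)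
      then have "b * alpha_conj r j e \<in> ?S (insert j T)"
        by (auto intro: rat_complex.span_base)
      moreover have "(of_rat c * b + w) * alpha_conj r j e =
          of_rat c * (b * alpha_conj r j e) + w * alpha_conj r j e"
        by (simp add: algebra_simps)
      ultimately show ?case
        using step(2) rat_complex.span_add rat_complex.span_scale by presburger
    qed
  qed
  have "(r j)\<^sup>2 \<in> ?L"
    using insert.prems subfield_Rats[OF L] by auto
  note K = hull_insert_sqrt[OF this]
  show ?case
  proof
    fix x assume "x \<in> complex_subfield hull (r ` insert j T)"
    then obtain a b where ab: "a \<in> ?L" "b \<in> ?L" "x = a + b * r j"
      using K by auto
    have "x = (a + b) * alpha_conj r j 0 + (a - b) * alpha_conj r j 1"
      by (simp add: ab alpha_conj_def field_simps)
    then show "x \<in> ?S (insert j T)"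
      using mult[OF subfield_add[OF L ab(1,2)], of 0] mult[OF subfield_diff[OF L ab(1,2)], of 1]
      by (simp add: rat_complex.span_add)
  qed
qed

lemma half_beta_cong:
  assumes "even (e + e')" "\<And>i. i \<in> {1..t-1} \<Longrightarrow> even (s i + s' i)"
  shows "half_beta t u r s e = half_beta t u r s' e'"
  unfolding half_beta_def using assms
  by (intro arg_cong2[where f = "(*)"] prod.cong alpha_conj_cong) (auto simp: flip_def)

lemma cnj_half_beta:
  assumes "\<And>i. i \<in> {1..t} \<Longrightarrow> cnj (r i) = (if u < i then - r i else r i)" "t \<ge> 1" "u \<le> t - 1"
  shows "cnj (half_beta t u r s e) = half_beta t u r s (e + 1)"
proof -
  have "cnj (alpha_conj r i n) = alpha_conj r i (n + flip u i 1)" if "i \<in> {1..t}" for i n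
    using assms(1)[OF that] by (auto simp: alpha_conj_def flip_def)
  note c = this
  have "u < t" using assms by auto
  have "cnj (half_beta t u r s e) = alpha_conj r t (e + flip u t 1) *
      (\<Prod>i=1..t-1. alpha_conj r i (s i + flip u i e + flip u i 1))"
    unfolding half_beta_def using assms(2) by (auto simp: c cnj_prod intro!: prod.cong)
  also have "\<dots> = half_beta t u r s (e + 1)"
    unfolding half_beta_def using \<open>u < t\<close>
    by (intro arg_cong2[where f = "(*)"] prod.cong) (auto simp: flip_def)
  finally show ?thesis .
qed

text \<open>A product of \<open>alpha_conj r i (s i)\<close> over all \<open>i \<le> t\<close> is a half with \<open>e = s t\<close>: the exponents with
\<open>u < i < t\<close> are corrected by the flip that \<open>e\<close> causes.\<close>

lemma KG_half_beta_span:
  assumes "\<And>i. i \<in> {1..t} \<Longrightarrow> (r i)\<^sup>2 \<in> \<rat>" "t \<ge> 1"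
  shows "KG t r \<subseteq> rat_complex.span {half_beta t u r s e |s e. s \<in> bits t}"
proof -
  have "range (\<lambda>s. \<Prod>i=1..t. alpha_conj r i (s i)) \<subseteq> {half_beta t u r s e |s e. s \<in> bits t}"
  proof
    fix x assume "x \<in> range (\<lambda>s. \<Prod>i=1..t. alpha_conj r i (s i))"
    then obtain s where x: "x = (\<Prod>i=1..t. alpha_conj r i (s i))"
      by auto
    define s' where "s' = (\<lambda>i\<in>{1..t-1}. (s i + flip u i (s t)) mod 2)"
    have s': "s' \<in> bits t"
      by (auto simp: s'_def bits_def)
    have "{1..t} = insert t {1..t-1}"
      using assms(2) by auto
    then have "x = alpha_conj r t (s t) * (\<Prod>i=1..t-1. alpha_conj r i (s i))"
      using assms(2) by (simp add: x)
    also have "(\<Prod>i=1..t-1. alpha_conj r i (s i)) =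
        (\<Prod>i=1..t-1. alpha_conj r i (s' i + flip u i (s t)))"
      by (intro prod.cong alpha_conj_cong) (auto simp: s'_def)
    finally have "x = half_beta t u r s' (s t)"
      by (simp add: half_beta_def)
    then show "x \<in> {half_beta t u r s e |s e. s \<in> bits t}"
      using s' by auto
  qed
  then show ?thesis
    using hull_sqrts_subset_span[of "{1..t}" r] assms(1) rat_complex.span_mono
    unfolding KG_def by (meson finite_atLeastAtMost subset_trans)
qed

text \<open>For \<open>\<epsilon> = 1\<close> this concerns the real and for \<open>\<epsilon> = -1\<close> the purely imaginary elements.  In both
cases \<open>2 x = x + \<epsilon> cnj x\<close>, and the map \<open>b \<mapsto> b + \<epsilon> cnj b\<close> sends every half into the span of \<open>B\<close>.\<close>

lemma eigenspace_subset_span: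
  fixes \<epsilon> :: complex
  assumes cnj: "\<And>i. i \<in> {1..t} \<Longrightarrow> cnj (r i) = (if u < i then - r i else r i)"
    and sq: "\<And>i. i \<in> {1..t} \<Longrightarrow> (r i)\<^sup>2 \<in> \<rat>" and tu: "t \<ge> 1" "u \<le> t - 1"
    and \<epsilon>: "\<epsilon> = 1 \<or> \<epsilon> = -1"
    and B: "\<And>s. s \<in> bits t \<Longrightarrow>
      half_beta t u r s 0 + \<epsilon> * half_beta t u r s 1 \<in> rat_complex.span B"
    and x: "x \<in> KG t r" "cnj x = \<epsilon> * x"
  shows "x \<in> rat_complex.span B"
proof -
  have "x \<in> rat_complex.span {half_beta t u r s e |s e. s \<in> bits t}"
    using KG_half_beta_span[of t r u] sq tu(1) x(1) by blast
  then have "x + \<epsilon> * cnj x \<in> rat_complex.span B"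
  proof (induction rule: rat_complex.span_induct_alt)
    case base
    then show ?case by (simp add: rat_complex.span_zero)
  next
    case (step c b w)
    then obtain s e where s: "s \<in> bits t" "b = half_beta t u r s e"
      by auto
    have conj: "cnj (half_beta t u r s e) = half_beta t u r s (e + 1)"
      using cnj_half_beta[of t r u] cnj tu by simp
    have "b + \<epsilon> * cnj b \<in> rat_complex.span B"
    proof (cases "even e")
      case True
      then have "b = half_beta t u r s 0" "cnj b = half_beta t u r s 1"
        unfolding s(2) conj by (intro half_beta_cong; simp)+
      then show ?thesis using B[OF s(1)] by simp
    next
      case False
      then have "b = half_beta t u r s 1" "cnj b = half_beta t u r s 0"
        unfolding s(2) conj by (intro half_beta_cong; simp)+
      then have "b + \<epsilon> * cnj b = \<epsilon> * (half_beta t u r s 0 + \<epsilon> * half_beta t u r s 1)"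
        using \<epsilon> by (auto simp: algebra_simps)
      then show ?thesis
        using B[OF s(1)] rat_complex.span_neg[OF B[OF s(1)]] \<epsilon> by (auto simp: algebra_simps)
    qed
    moreover have "(of_rat c * b + w) + \<epsilon> * cnj (of_rat c * b + w) =
        of_rat c * (b + \<epsilon> * cnj b) + (w + \<epsilon> * cnj w)"
    proof -
      have "cnj (of_rat c) = of_rat c"
        using subfield_Rats[OF complex_subfield_Reals] Rats_of_rat[of c] Reals_cnj_iff by blast
      then show ?thesis by (simp add: algebra_simps)
    qed
    ultimately show ?case
      using step(2) rat_complex.span_add rat_complex.span_scale by presburger
  qed
  moreover have "x + \<epsilon> * cnj x = 2 * x"
    using x(2) \<epsilon> by auto
  ultimately have "of_rat (1/2) * (2 * x) \<in> rat_complex.span B"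
    using rat_complex.span_scale by metis
  then show ?thesis
    by (simp add: of_rat_divide)
qed

section \<open>Integral bases from dual families\<close>

text \<open>The functional \<open>\<phi> j\<close> reads off \<open>D\<close> times the \<open>j\<close>-th coordinate.  Coordinates are therefore unique;
those of an element of \<open>M\<close> are rational numbers \<open>c\<close> with \<open>c D\<close> an algebraic integer, so
\<open>c\<^sup>2 n\<close> is an integer, and \<open>c\<close> is one because \<open>n\<close> is squarefree.\<close>

lemma Z_basis_by_duality:
  fixes b :: "'a \<Rightarrow> complex" and \<phi> :: "'a \<Rightarrow> complex \<Rightarrow> complex" and D :: complex
  assumes I: "finite I" and M: "int_complex.subspace M" "b ` I \<subseteq> M" "M \<subseteq> rat_complex.span (b ` I)"
    and coord: "\<And>c j. j \<in> I \<Longrightarrow> \<phi> j (\<Sum>i\<in>I. of_rat (c i) * b i) = of_rat (c j) * D"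
    and integral: "\<And>x j. x \<in> M \<Longrightarrow> j \<in> I \<Longrightarrow> algebraic_int (\<phi> j x)"
    and D: "D\<^sup>2 = of_int n" "squarefree n" "n \<noteq> 0"
  shows "Z_basis (b ` I) M"
proof -
  have D0: "D \<noteq> 0"
    using D by auto
  (* A statement about families indexed by I: it gives independence and also injectivity of b,
     which turns sums over the set of values into sums over I. *)
  have coeffs_unique: "c j = c' j"
    if "(\<Sum>i\<in>I. of_rat (c i) * b i) = (\<Sum>i\<in>I. of_rat (c' i) * b i)" "j \<in> I" for c c' j
    using coord[OF that(2), of c] coord[OF that(2), of c'] that(1) D0 by simp
  have inj: "inj_on b I"
  proof
    fix i j assume ij: "i \<in> I" "j \<in> I" "b i = b j"
    have "(\<Sum>k\<in>I. of_rat (if k = l then 1 else 0) * b k) = b l" if "l \<in> I" for l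
      using I that by (simp add: if_distrib[of of_rat] if_distrib[of "\<lambda>x. x * _"] sum.delta cong: if_cong)
    then have "(if i = i then 1 else 0 :: rat) = (if i = j then 1 else 0)"
      using ij by (intro coeffs_unique[of "\<lambda>k. if k = i then 1 else 0" "\<lambda>k. if k = j then 1 else 0" i]) auto
    then show "i = j"
      by (metis zero_neq_one)
  qed
  have "int_complex.independent (b ` I)"
  proof
    assume "int_complex.dependent (b ` I)"
    then obtain f v where f: "v \<in> b ` I" "f v \<noteq> 0" "(\<Sum>v\<in>b ` I. of_int (f v) * v) = 0"
      using int_complex.dependent_finite[of "b ` I"] I by auto
    then obtain j where j: "j \<in> I" "v = b j" by auto
    have "(\<Sum>i\<in>I. of_rat (of_int (f (b i))) * b i) = (\<Sum>i\<in>I. of_rat 0 * b i)"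
      using f(3) by (simp add: sum.reindex[OF inj])
    from coeffs_unique[OF this j(1)] show False
      using f j by simp
  qed
  moreover have "int_complex.span (b ` I) = M"
  proof
    show "int_complex.span (b ` I) \<subseteq> M"
      using M by (intro int_complex.span_minimal)
    show "M \<subseteq> int_complex.span (b ` I)"
    proof
      fix x assume x: "x \<in> M"
      then have "x \<in> rat_complex.span (b ` I)"
        using M by auto
      then obtain f where "x = (\<Sum>v\<in>b ` I. of_rat (f v) * v)"
        using rat_complex.span_finite[of "b ` I"] I by auto
      then have xc: "x = (\<Sum>i\<in>I. of_rat (f (b i)) * b i)"
        by (simp add: sum.reindex[OF inj])
      show "x \<in> int_complex.span (b ` I)"
        unfolding xc
      proof (rule int_complex.span_sum)
        fix j assume j: "j \<in> I"
        have int: "algebraic_int (of_rat (f (b j)) * D)"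
          using integral[OF x j] coord[OF j, of "\<lambda>i. f (b i)"] xc by simp
        note algebraic_int_mult[OF int int]
        moreover have "(of_rat (f (b j)) * D) * (of_rat (f (b j)) * D) = (of_rat (f (b j)))\<^sup>2 * of_int n"
          by (simp add: D(1)[symmetric] power2_eq_square)
        ultimately have "(of_rat (f (b j)) :: complex) \<in> \<int>"
          using D(2) by (intro rational_int_if_square_times_squarefree_int[of _ n]) auto
        then obtain k where "(of_rat (f (b j)) :: complex) = of_int k"
          by (auto elim: Ints_cases)
        then show "of_rat (f (b j)) * b j \<in> int_complex.span (b ` I)"
          using j by (simp add: int_complex.span_base int_complex.span_scale)
      qed
    qed
  qed
  ultimately show ?thesis
    by (simp add: Z_basis_def)
qed

section \<open>Prime discriminants and their square roots\<close>

lemma odd_prime_discriminant: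
  assumes "prime_discriminant x" "odd x"
  shows "squarefree x" "\<not> is_unit x" "4 dvd 1 - x"
proof -
  obtain p :: nat where p: "prime p" "odd p" "x = (-1) ^ ((p - 1) div 2) * int p"
    using assms by (auto simp: prime_discriminant_def)
  define k where "k = (p - 1) div 2"
  have pk: "p = 2 * k + 1"
    using p(2) by (auto simp: k_def)
  have x: "x = int p \<and> even k \<or> x = - int p \<and> odd k"
    using p(3) by (cases "even k") (auto simp: k_def)
  have "prime (int p)"
    using p(1) by simp
  then have "squarefree (int p)" "\<not> is_unit (int p)"
    by (auto simp: squarefree_prime)
  then show "squarefree x" "\<not> is_unit x"
    using x by auto
  show "4 dvd 1 - x"
    using x pk by presburger
qed

lemma sqrt_squarefree_irrational:
  fixes c :: complex
  assumes "c\<^sup>2 = of_int n" "squarefree n" "\<not> is_unit n"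
  shows "c \<notin> \<rat>"
proof
  assume "c \<in> \<rat>"
  then have "c \<in> \<int>"
    using assms(1) rational_int_if_square_times_squarefree_int[of c 1] by simp
  then obtain k where k: "c = of_int k"
    by (auto elim: Ints_cases)
  then have "of_int (k\<^sup>2) = (of_int n :: complex)"
    using assms(1) by simp
  then have "k\<^sup>2 = n"
    by (simp only: of_int_eq_iff)
  then have "is_unit k"
    using assms(2) by (auto simp: squarefree_def)
  then have "is_unit (k\<^sup>2)"
    by (simp only: is_unit_power_iff simp_thms)
  then show False
    using assms(3) \<open>k\<^sup>2 = n\<close> by simp
qed

lemma odd_number_of_negative_factors:
  fixes q :: "nat \<Rightarrow> int"
  assumes "(\<Prod>i=1..t. q i) < 0" "u \<le> t"
    and "\<And>i. i \<in> {1..u} \<Longrightarrow> q i > 0" "\<And>i. i \<in> {u<..t} \<Longrightarrow> q i < 0"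
  shows "odd (t - u)"
proof
  assume even: "even (t - u)"
  have "{1..t} = {1..u} \<union> {u<..t}"
    using assms(2) by auto
  then have "(\<Prod>i=1..t. q i) = (\<Prod>i=1..u. q i) * (\<Prod>i\<in>{u<..t}. q i)"
    by (simp only:) (rule prod.union_disjoint, auto)
  also have "(\<Prod>i\<in>{u<..t}. q i) = (\<Prod>i\<in>{u<..t}. (-1) * (- q i))"
    by simp
  also have "\<dots> = (\<Prod>i\<in>{u<..t}. - q i)"
    using even unfolding prod.distrib by simp
  finally have "(\<Prod>i=1..t. q i) = (\<Prod>i=1..u. q i) * (\<Prod>i\<in>{u<..t}. - q i)" .
  moreover have "(\<Prod>i=1..u. q i) * (\<Prod>i\<in>{u<..t}. - q i) > 0"
    using assms(3,4) by (intro mult_pos_pos prod_pos) auto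
  ultimately show False
    using assms(1) by simp
qed

text \<open>For \<open>n = 1 - 4 m\<close> both \<open>(1 + r\<^sub>i) / 2\<close> and \<open>(1 - r\<^sub>i) / 2\<close> are roots of \<open>X\<^sup>2 - X + m\<close>.\<close>

lemma algebraic_int_alpha_conj:
  assumes "(r i)\<^sup>2 = of_int n" "4 dvd 1 - n"
  shows "algebraic_int (alpha_conj r i k)"
proof -
  obtain m where m: "1 - n = 4 * m"
    using assms(2) by auto
  then have n: "n = 1 - 4 * m" by simp
  show ?thesis
  proof (rule algebraic_int.intros)
    show "lead_coeff [:of_int m, -1, 1 :: complex:] = 1"
      by simp
    show "\<forall>i. coeff [:of_int m, -1, 1 :: complex:] i \<in> \<int>"
      by (auto simp: coeff_pCons split: nat.splits)
    have "(r i * r i) = 1 - 4 * of_int m"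
      using assms(1) by (simp add: n power2_eq_square)
    moreover have "4 * poly [:of_int m, -1, 1:] (alpha_conj r i k) = 4 * of_int m - 1 + r i * r i"
      by (cases "even k") (simp_all add: alpha_conj_def field_simps)
    ultimately have "4 * poly [:of_int m, -1, 1:] (alpha_conj r i k) = 0"
      by simp
    then show "poly [:of_int m, -1, 1:] (alpha_conj r i k) = 0"
      by (simp only: mult_eq_0_iff) simp
  qed
qed

lemma cnj_sqrt_of_int:
  fixes z :: complex
  assumes "z\<^sup>2 = of_int n"
  shows "n > 0 \<Longrightarrow> cnj z = z" "n < 0 \<Longrightarrow> cnj z = - z"
proof -
  have re: "(Re z)\<^sup>2 - (Im z)\<^sup>2 = of_int n" and im: "Re z = 0 \<or> Im z = 0"
    using arg_cong[OF assms, of Re] arg_cong[OF assms, of Im] by (auto simp: power2_eq_square)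
  show "cnj z = z" if "n > 0"
  proof -
    have "Re z \<noteq> 0"
    proof
      assume "Re z = 0"
      then have "- (Im z)\<^sup>2 > 0"
        using re that by simp
      then show False by simp
    qed
    then show ?thesis
      using im by (simp add: complex_eq_iff)
  qed
  show "cnj z = - z" if "n < 0"
  proof -
    have "Im z \<noteq> 0"
    proof
      assume "Im z = 0"
      then have "(Re z)\<^sup>2 < 0"
        using re that by simp
      then show False by simp
    qed
    then show ?thesis
      using im by (simp add: complex_eq_iff)
  qed
qed

section \<open>The signed trace on the field generated by the square roots\<close>

lemma KG_subfield: "complex_subfield (KG t r)"
  by (simp add: KG_def complex_subfield_hull)

lemma KG_generator: "i \<in> {1..t} \<Longrightarrow> r i \<in> KG t r"
  by (auto simp: KG_def intro: hull_inc)

lemma alpha_conj_alt: "alpha_conj r i n = of_rat (1 / 2) * (1 + of_int ((-1) ^ n) * r i)"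
  by (simp add: alpha_conj_def of_rat_divide)

lemma KG_of_rat: "of_rat c \<in> KG t r"
  using subfield_Rats[OF KG_subfield[of t r]] by auto

lemma alpha_conj_in_KG: "i \<in> {1..t} \<Longrightarrow> alpha_conj r i n \<in> KG t r"
  unfolding alpha_conj_alt
  by (intro subfield_mult[OF KG_subfield] subfield_add[OF KG_subfield] subfield_one[OF KG_subfield]
      subfield_of_int[OF KG_subfield] KG_generator KG_of_rat)

lemma half_beta_in_KG: "t \<ge> 1 \<Longrightarrow> half_beta t u r s e \<in> KG t r"
  unfolding half_beta_def
  by (intro subfield_mult[OF KG_subfield] subfield_prod[OF KG_subfield] alpha_conj_in_KG) auto

lemma half_beta_algebraic_int:
  assumes "t \<ge> 1" "\<And>i n. i \<in> {1..t} \<Longrightarrow> algebraic_int (alpha_conj r i n)"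
  shows "algebraic_int (half_beta t u r s e)"
  unfolding half_beta_def using assms
  by (intro algebraic_int_mult algebraic_int_prod) auto

lemma endo_half_beta:
  assumes \<sigma>: "subfield_endo (KG t r) \<sigma>" and "t \<ge> 1" and r': "\<And>i. i \<in> {1..t} \<Longrightarrow> \<sigma> (r i) = r' i"
  shows "\<sigma> (half_beta t u r s e) = half_beta t u r' s e"
proof -
  note K = KG_subfield[of t r]
  note closed = subfield_mult[OF K] subfield_add[OF K] subfield_one[OF K] subfield_of_int[OF K]
    KG_generator alpha_conj_in_KG subfield_prod[OF K]
  have a: "\<sigma> (alpha_conj r i n) = alpha_conj r' i n" if i: "i \<in> {1..t}" for i n
  proof -
    have "\<sigma> (alpha_conj r i n) = \<sigma> (of_rat (1 / 2)) * (\<sigma> 1 + \<sigma> (of_int ((-1) ^ n)) * \<sigma> (r i))"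
      unfolding alpha_conj_alt using i
      by (simp only: subfield_endoD(3,4)[OF \<sigma>] closed KG_of_rat)
    then show ?thesis
      unfolding endo_of_rat[OF K \<sigma>] endo_of_int[OF K \<sigma>] subfield_endoD(2)[OF \<sigma>] r'[OF i]
      by (simp only: alpha_conj_alt)
  qed
  have "\<sigma> (half_beta t u r s e) = \<sigma> (alpha_conj r t e) *
      \<sigma> (\<Prod>i=1..t-1. alpha_conj r i (s i + flip u i e))"
    unfolding half_beta_def using assms(2) by (intro subfield_endoD(4)[OF \<sigma>] closed) auto
  also have "\<sigma> (\<Prod>i=1..t-1. alpha_conj r i (s i + flip u i e)) =
      (\<Prod>i=1..t-1. \<sigma> (alpha_conj r i (s i + flip u i e)))"
    by (intro endo_prod[OF K \<sigma>] closed) auto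
  finally show ?thesis
    unfolding half_beta_def using assms(2) a by (auto intro!: prod.cong)
qed

definition signed_trace :: "nat \<Rightarrow> (nat \<Rightarrow> complex) \<Rightarrow> complex \<Rightarrow> complex" where
  "signed_trace t r x = (\<Sum>\<mu>\<in>bits t. (-1) ^ (\<Sum>j=1..t-1. \<mu> j) * tau_prod t r \<mu> x)"

lemma signed_trace_rat_linear:
  assumes \<sigma>: "\<And>\<mu>. subfield_endo (KG t r) (tau_prod t r \<mu>)" and f: "\<And>i. i \<in> I \<Longrightarrow> f i \<in> KG t r"
  shows "signed_trace t r (\<Sum>i\<in>I. of_rat (c i) * f i) = (\<Sum>i\<in>I. of_rat (c i) * signed_trace t r (f i))"
proof -
  note K = KG_subfield[of t r]
  have "tau_prod t r \<mu> (\<Sum>i\<in>I. of_rat (c i) * f i) = (\<Sum>i\<in>I. of_rat (c i) * tau_prod t r \<mu> (f i))" for \<mu>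
    using f by (simp add: KG_of_rat endo_sum[OF K \<sigma>] subfield_mult[OF K] subfield_endoD(4)[OF \<sigma>] endo_of_rat[OF K \<sigma>])
  then show ?thesis
    unfolding signed_trace_def
    by (simp add: sum_distrib_left mult.left_commute sum.swap[of _ I])
qed

lemma signed_trace_algebraic_int:
  assumes \<sigma>: "\<And>\<mu>. subfield_endo (KG t r) (tau_prod t r \<mu>)" and x: "x \<in> KG t r" "algebraic_int x"
  shows "algebraic_int (signed_trace t r x)"
  unfolding signed_trace_def
  by (intro algebraic_int_sum algebraic_int_mult endo_algebraic_int[OF KG_subfield \<sigma> x])
    (simp add: int_imp_algebraic_int)

lemma signed_trace_duality:
  assumes tu: "t \<ge> 1" "u \<le> t - 1" "odd (t - u)" and \<eta>: "\<eta> \<in> bits t" and \<nu>: "\<nu> \<in> bits t"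
    and \<sigma>: "\<And>\<mu>. subfield_endo (KG t r) (tau_prod t r \<mu>)"
    and gen: "\<And>\<mu> i. i \<in> {1..t} \<Longrightarrow> tau_prod t r \<mu> (r i) = twist t \<mu> r i"
  shows "signed_trace t r (beta t u r \<eta> * beta_star t u r \<nu>) =
    (if \<eta> = \<nu> then \<Prod>i=1..t. r i else 0)"
proof -
  note K = KG_subfield[of t r]
  have hb: "tau_prod t r \<mu> (half_beta t u r s e) = half_beta t u (twist t \<mu> r) s e" for \<mu> s e
    using endo_half_beta[OF \<sigma> tu(1) gen] by simp
  note closed = half_beta_in_KG[OF tu(1)] subfield_add[OF K] subfield_diff[OF K] subfield_mult[OF K]
    subfield_of_int[OF K]
  have b: "tau_prod t r \<mu> (beta t u r \<eta>) = beta t u (twist t \<mu> r) \<eta>" for \<mu>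
    unfolding beta_eq_half_beta[OF \<eta> tu(2)] by (simp only: subfield_endoD(3)[OF \<sigma>] closed hb)
  have bs: "tau_prod t r \<mu> (beta_star t u r \<nu>) = beta_star t u (twist t \<mu> r) \<nu>" for \<mu>
  proof -
    (* The sign is an integer of the field, so the endomorphism fixes it. *)
    have *: "(-1) ^ n = (of_int ((-1) ^ n) :: complex)" for n by simp
    show ?thesis
      unfolding beta_star_eq_half_beta[OF \<nu> tu(2)] *
      by (simp only: subfield_endoD(4)[OF \<sigma>] closed hb endo_of_int[OF K \<sigma>] endo_diff[OF K \<sigma>])
  qed
  have bK: "beta t u r \<eta> \<in> KG t r"
    unfolding beta_eq_half_beta[OF \<eta> tu(2)] by (intro closed)
  have bsK: "beta_star t u r \<nu> \<in> KG t r"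
  proof -
    have *: "(-1) ^ n = (of_int ((-1) ^ n) :: complex)" for n by simp
    show ?thesis
      unfolding beta_star_eq_half_beta[OF \<nu> tu(2)] * by (intro closed)
  qed
  show ?thesis
    unfolding signed_trace_def subfield_endoD(4)[OF \<sigma> bK bsK] b bs
    by (rule beta_duality[OF tu \<eta> \<nu>])
qed

section \<open>The integral bases\<close>

theorem theorem9:
  fixes d :: int and t u :: nat and q :: "nat \<Rightarrow> int" and r :: "nat \<Rightarrow> complex"
  assumes "d < 0"
    and "imaginary_quadratic_discriminant d"
    and "prime_discriminant_factorization d t q"
    and "\<And>i. i \<in> {1..t} \<Longrightarrow> odd (q i)"
    and "t \<ge> 1" and "u \<le> t - 1"
    and "\<And>i. i \<in> {1..u} \<Longrightarrow> q i > 0"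
    and "\<And>i. i \<in> {u<..t} \<Longrightarrow> q i < 0"
    and "\<And>i. i \<in> {1..t} \<Longrightarrow> (r i)\<^sup>2 = of_int (q i)"
  shows "Z_basis (beta t u r ` bits t) (ring_of_integers (KG t r \<inter> \<real>)) \<and>
    Z_basis (beta_star t u r ` bits t) (ring_of_integers (KG t r) \<inter> imaginary_axis) \<and>
    (\<forall>\<eta>\<in>bits t. \<forall>\<nu>\<in>bits t.
       (\<Sum>\<mu>\<in>bits t. (-1) ^ (\<Sum>j=1..t-1. \<mu> j) * tau_prod t r \<mu> (beta t u r \<eta> * beta_star t u r \<nu>)) =
       (if \<eta> = \<nu> then (\<Prod>i=1..t. r i) else 0))"
proof -
  let ?K = "KG t r" and ?D = "\<Prod>i=1..t. r i"
  note K = KG_subfield[of t r]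
  have pd: "\<And>i. i \<in> {1..t} \<Longrightarrow> prime_discriminant (q i)"
    and cop: "\<And>i j. i \<in> {1..t} \<Longrightarrow> j \<in> {1..t} \<Longrightarrow> i \<noteq> j \<Longrightarrow> coprime (q i) (q j)"
    and d: "d = (\<Prod>i=1..t. q i)"
    using assms(3) unfolding prime_discriminant_factorization_def by blast+
  have q: "squarefree (q i)" "\<not> is_unit (q i)" "4 dvd 1 - q i" if "i \<in> {1..t}" for i
    using odd_prime_discriminant[OF pd[OF that] assms(4)[OF that]] .
  have sqf: "squarefree (prod q U)" if "U \<subseteq> {1..t}" for U
    using that by (intro squarefree_prod_coprime cop q(1)) auto
  have prod_sq: "(prod r U)\<^sup>2 = of_int (prod q U)" if "U \<subseteq> {1..t}" for U
    unfolding prod_power_distrib of_int_prod using that assms(9) by (intro prod.cong) auto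
  have irr: "prod r U \<notin> \<rat>" if U: "U \<noteq> {}" "U \<subseteq> {1..t}" for U
  proof -
    obtain i where "i \<in> U" using U by auto
    then have "q i dvd prod q U" "\<not> is_unit (q i)"
      using U q(2) finite_subset[OF U(2)] by auto
    then have "\<not> is_unit (prod q U)"
      by (meson dvd_trans)
    then show ?thesis
      using prod_sq sqf U(2) by (intro sqrt_squarefree_irrational) auto
  qed
  have sq: "(r i)\<^sup>2 \<in> \<rat>" if "i \<in> {1..t}" for i
    using assms(9)[OF that] by simp
  have \<sigma>: "subfield_endo ?K (tau_prod t r \<mu>)" for \<mu>
    using tau_prod_is_endo[of t r] sq irr by simp
  have gen: "tau_prod t r \<mu> (r i) = twist t \<mu> r i" if "i \<in> {1..t}" for \<mu> i
    using tau_prod_generator[of t r i] sq irr that by (simp add: twist_def)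
  have parity: "odd (t - u)"
    using odd_number_of_negative_factors[of q t u] assms(1,5-8) d by auto
  note tu = assms(5,6) parity
  have duality: "signed_trace t r (beta t u r \<eta> * beta_star t u r \<nu>) = (if \<eta> = \<nu> then ?D else 0)"
    if "\<eta> \<in> bits t" "\<nu> \<in> bits t" for \<eta> \<nu>
    using signed_trace_duality[OF tu that] \<sigma> gen by simp
  have cnj_r: "cnj (r i) = (if u < i then - r i else r i)" if "i \<in> {1..t}" for i
    using cnj_sqrt_of_int[OF assms(9)[OF that]] assms(7,8) that by auto
  have cnj_hb: "cnj (half_beta t u r s 0) = half_beta t u r s 1"
    "cnj (half_beta t u r s 1) = half_beta t u r s 0" for s
  proof -
    have hb: "cnj (half_beta t u r s e) = half_beta t u r s (e + 1)" for e
      using cnj_half_beta[of t r u] cnj_r assms(5,6) by simp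
    show "cnj (half_beta t u r s 0) = half_beta t u r s 1"
      using hb[of 0] by simp
    show "cnj (half_beta t u r s 1) = half_beta t u r s 0"
      by (rule trans[OF hb half_beta_cong]) simp_all
  qed
  have hb_int: "algebraic_int (half_beta t u r s e)" for s e
    using assms(5,9) q(3) by (intro half_beta_algebraic_int algebraic_int_alpha_conj) auto
  note hbK = half_beta_in_KG[OF assms(5)]
  have sgn: "(-1) ^ n = (of_int ((-1) ^ n) :: complex)" for n
    by simp
  have beta: "beta t u r s \<in> ?K" "cnj (beta t u r s) = beta t u r s" "algebraic_int (beta t u r s)"
    if "s \<in> bits t" for s
    unfolding beta_eq_half_beta[OF that assms(6)]
    by (auto simp: cnj_hb[unfolded One_nat_def] hbK subfield_add[OF K] intro: algebraic_int_add hb_int)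
  have beta_star: "beta_star t u r s \<in> ?K" "cnj (beta_star t u r s) = - beta_star t u r s"
    "algebraic_int (beta_star t u r s)" if "s \<in> bits t" for s
  proof -
    show "beta_star t u r s \<in> ?K"
      unfolding beta_star_eq_half_beta[OF that assms(6)] sgn
      by (intro subfield_mult[OF K] subfield_diff[OF K] subfield_of_int[OF K] hbK)
    show "cnj (beta_star t u r s) = - beta_star t u r s"
      unfolding beta_star_eq_half_beta[OF that assms(6)] by (simp add: cnj_hb[unfolded One_nat_def] algebra_simps)
    have "algebraic_int (half_beta t u r s 0 - half_beta t u r s 1)"
      using algebraic_int_add[OF hb_int algebraic_int_minus[OF hb_int]] by simp
    then show "algebraic_int (beta_star t u r s)"
      unfolding beta_star_eq_half_beta[OF that assms(6)] sgn by (rule algebraic_int_mult[OF algebraic_int_of_int])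
  qed
  have D: "?D\<^sup>2 = of_int d" "squarefree d" "d \<noteq> 0"
    using prod_sq[OF subset_refl, folded d] sqf[OF subset_refl, folded d] assms(1) by simp_all
  have trace_int: "algebraic_int (signed_trace t r (x * y))"
    if "x \<in> ?K" "algebraic_int x" "y \<in> ?K" "algebraic_int y" for x y
    using that by (intro signed_trace_algebraic_int \<sigma> subfield_mult[OF K] algebraic_int_mult)
  have real: "x \<in> \<real> \<longleftrightarrow> cnj x = 1 * x" for x
    by (simp add: Reals_cnj_iff)
  have imag: "x \<in> imaginary_axis \<longleftrightarrow> cnj x = (-1) * x" for x
  proof
    assume "cnj x = (-1) * x"
    then have "x = \<i> * of_real (Im x)"
      by (simp add: complex_eq_iff)
    then show "x \<in> imaginary_axis"
      by (auto simp: imaginary_axis_def)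
  qed (auto simp: imaginary_axis_def)
  have "Z_basis (beta t u r ` bits t) (ring_of_integers (?K \<inter> \<real>))"
  proof (rule Z_basis_by_duality[where \<phi> = "\<lambda>j x. signed_trace t r (x * beta_star t u r j)", OF finite_bits _ _ _ _ _ D])
    show "int_complex.subspace (ring_of_integers (?K \<inter> \<real>))"
      unfolding int_complex.subspace_def ring_of_integers_def
      by (auto simp: subfield_zero[OF K] subfield_add[OF K] subfield_mult[OF K] subfield_of_int[OF K]
          intro: algebraic_int_add algebraic_int_mult)
    show "beta t u r ` bits t \<subseteq> ring_of_integers (?K \<inter> \<real>)"
      using beta by (auto simp: ring_of_integers_def real)
    show "ring_of_integers (?K \<inter> \<real>) \<subseteq> rat_complex.span (beta t u r ` bits t)"
    proof
      fix x assume "x \<in> ring_of_integers (?K \<inter> \<real>)"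
      then have x: "x \<in> ?K" "cnj x = 1 * x"
        by (auto simp: ring_of_integers_def Reals_cnj_iff)
      have "half_beta t u r s 0 + 1 * half_beta t u r s 1 \<in> rat_complex.span (beta t u r ` bits t)"
        if "s \<in> bits t" for s
        unfolding mult_1_left beta_eq_half_beta[OF that assms(6), symmetric]
        using that by (intro rat_complex.span_base imageI)
      then show "x \<in> rat_complex.span (beta t u r ` bits t)"
        using eigenspace_subset_span[of t r u 1 _ x] cnj_r sq assms(5,6) x by blast
    qed
    show "signed_trace t r ((\<Sum>i\<in>bits t. of_rat (c i) * beta t u r i) * beta_star t u r j) =
        of_rat (c j) * ?D" if j: "j \<in> bits t" for c j
    proof -
      have "signed_trace t r ((\<Sum>i\<in>bits t. of_rat (c i) * beta t u r i) * beta_star t u r j) =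
          signed_trace t r (\<Sum>i\<in>bits t. of_rat (c i) * (beta t u r i * beta_star t u r j))"
        by (simp add: sum_distrib_right mult.assoc)
      also have "\<dots> = (\<Sum>i\<in>bits t. of_rat (c i) * signed_trace t r (beta t u r i * beta_star t u r j))"
        using j beta(1) beta_star(1) by (intro signed_trace_rat_linear \<sigma> subfield_mult[OF K]) auto
      also have "\<dots> = (\<Sum>i\<in>bits t. if i = j then of_rat (c i) * ?D else 0)"
        using duality j by (intro sum.cong) auto
      finally show ?thesis
        using j finite_bits by simp
    qed
    show "algebraic_int (signed_trace t r (x * beta_star t u r j))"
      if "x \<in> ring_of_integers (?K \<inter> \<real>)" "j \<in> bits t" for x j
      using that beta_star by (intro trace_int) (auto simp: ring_of_integers_def)
  qed
  moreover have "Z_basis (beta_star t u r ` bits t) (ring_of_integers ?K \<inter> imaginary_axis)"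
  proof (rule Z_basis_by_duality[where \<phi> = "\<lambda>j x. signed_trace t r (beta t u r j * x)", OF finite_bits _ _ _ _ _ D])
    show "int_complex.subspace (ring_of_integers ?K \<inter> imaginary_axis)"
      unfolding int_complex.subspace_def ring_of_integers_def
      by (auto simp: imag subfield_zero[OF K] subfield_add[OF K] subfield_mult[OF K] subfield_of_int[OF K]
          intro: algebraic_int_add algebraic_int_mult)
    show "beta_star t u r ` bits t \<subseteq> ring_of_integers ?K \<inter> imaginary_axis"
      using beta_star by (auto simp: ring_of_integers_def imag)
    show "ring_of_integers ?K \<inter> imaginary_axis \<subseteq> rat_complex.span (beta_star t u r ` bits t)"
    proof
      fix x assume "x \<in> ring_of_integers ?K \<inter> imaginary_axis"
      then have x: "x \<in> ?K" "cnj x = (-1) * x"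
        unfolding ring_of_integers_def by (auto simp: imag)
      have "half_beta t u r s 0 + (-1) * half_beta t u r s 1 \<in> rat_complex.span (beta_star t u r ` bits t)"
        if "s \<in> bits t" for s
      proof -
        let ?n = "\<Sum>i=1..t-1. s i"
        have "half_beta t u r s 0 + (-1) * half_beta t u r s 1 = of_rat ((-1) ^ ?n) * beta_star t u r s"
          unfolding beta_star_eq_half_beta[OF that assms(6)]
          by (cases "even ?n") simp_all
        then show ?thesis
          using that by (simp only:) (intro rat_complex.span_scale rat_complex.span_base imageI)
      qed
      then show "x \<in> rat_complex.span (beta_star t u r ` bits t)"
        using eigenspace_subset_span[of t r u "-1" _ x] cnj_r sq assms(5,6) x by blast
    qed
    show "signed_trace t r (beta t u r j * (\<Sum>i\<in>bits t. of_rat (c i) * beta_star t u r i)) =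
        of_rat (c j) * ?D" if j: "j \<in> bits t" for c j
    proof -
      have "signed_trace t r (beta t u r j * (\<Sum>i\<in>bits t. of_rat (c i) * beta_star t u r i)) =
          signed_trace t r (\<Sum>i\<in>bits t. of_rat (c i) * (beta t u r j * beta_star t u r i))"
        by (simp add: sum_distrib_left mult.left_commute)
      also have "\<dots> = (\<Sum>i\<in>bits t. of_rat (c i) * signed_trace t r (beta t u r j * beta_star t u r i))"
        using j beta(1) beta_star(1) by (intro signed_trace_rat_linear \<sigma> subfield_mult[OF K]) auto
      also have "\<dots> = (\<Sum>i\<in>bits t. if j = i then of_rat (c i) * ?D else 0)"
        using duality j by (intro sum.cong) auto
      finally show ?thesis
        using j finite_bits by simp
    qed
    show "algebraic_int (signed_trace t r (beta t u r j * x))"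
      if "x \<in> ring_of_integers ?K \<inter> imaginary_axis" "j \<in> bits t" for x j
      using that beta by (intro trace_int) (auto simp: ring_of_integers_def)
  qed
  ultimately show ?thesis
    using duality unfolding signed_trace_def by blast
qed

end
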